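(* Let $f_1,\dots,f_n$, $W$, the iterates $x_{(i)}(k)$, and the constants $L_h, L_{\bar f}, D,\beta$ be as in the context, and let the stepsize $\alpha>0$ satisfy $\alpha\le\min\{(1+\lambda_n(W))/L_h,\,1/L_{\bar f}\}$. Let $\bar x(k)=\frac1n\sum_{i=1}^n x_{(i)}(k)$ and $\bar r(k)=\bar f(\bar x(k))-\bar f^*$. Since $\bar f$ is convex, for all $i=1,2,\dots,n$, $$\bar f(x_{(i)}(k))-\bar f^*\le\bar r(k)+\langle\nabla\bar f(x_{(i)}(k)),x_{(i)}(k)-\bar x(k)\rangle\le\bar r(k)+\frac1n\sum_{j=1}^n\|\nabla f_j(x_{(i)}(k))\|\,\|x_{(i)}(k)-\bar x(k)\|\le\bar r(k)+\frac{\alpha D^2}{1-\beta}.$$ Consequently $\bar f(x_{(i)}(k))-\bar f^*$, like $\bar r(k)$, converges at $O(1/k)$ until reaching $O(\frac{\alpha}{1-\beta})$. This nearly sublinear convergence rate is stronger than those known for the distributed subgradient method and the dual averaging subgradient method, whose rates are in terms of the objective error $f(\hat x_{(i)}(k))-f^*$ ($f^*$ the optimal value of $f$) evaluated at the ergodic solution $\hat x_{(i)}(k)=\frac1k\sum_{s=0}^{k-1}x_{(i)}(s)$.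
   Context: Setting: $n$ agents in a network seek to minimize $f(x)=\sum_{i=1}^n f_i(x)$ over $x\in\mathbb{R}^p$; the set $\mathcal{X}^*$ of minimizers of $f$ is assumed non-empty. Assumptions: (a) For $i=1,\dots,n$, $f_i$ is proper closed convex, lower bounded, and Lipschitz differentiable, i.e. $\nabla f_i$ is Lipschitz continuous with constant $L_{f_i}>0$. (b) The network has a synchronized clock (all agents apply the iteration at the same time intervals), the network is connected, and the mixing matrix $W=[w_{ij}]\in\mathbb{R}^{n\times n}$ is symmetric and doubly stochastic, with eigenvalues $1=\lambda_1(W)\ge\dots\ge\lambda_n(W)\ge-1$ and $\beta:=\max\{|\lambda_2(W)|,|\lambda_n(W)|\}<1$. Iteration: $x_{(i)}(0)=0$ and $x_{(i)}(k+1)=\sum_{j=1}^n w_{ij}x_{(j)}(k)-\alpha\nabla f_i(x_{(i)}(k))$, $i=1,\dots,n$. Notation: $\bar f=\frac1n\sum_{i=1}^n f_i$, $\bar f^*=\bar f(x^* )$ for $x^*\in\mathcal{X}^*$; $L_h=\max_iL_{f_i}$; $L_{\bar f}=\frac1n\sum_{i=1}^nL_{f_i}$; $D=\sqrt{2L_h(\sum_{i=1}^n f_i(0)-f^o)}$ with $f^o=\sum_{i=1}^n f_i(x_{(i)}^o)$, $x_{(i)}^o=\arg\min_x f_i(x)$. Norms are Euclidean. It is known in this setting that $\bar r(k)$ decreases at a rate of $O(\frac1{\alpha k})=O(1/k)$ until reaching $O(\frac{\alpha}{1-\beta})$. *)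

theory Defs
  imports "HOL-Analysis.Analysis"
begin

subsection \<open>Objectives\<close>

definition grad :: "('a::euclidean_space \<Rightarrow> real) \<Rightarrow> 'a \<Rightarrow> 'a" where
  "grad h x = (THE d. GDERIV h x :> d)"

definition minimizers :: "('a \<Rightarrow> real) \<Rightarrow> 'a set" where
  "minimizers h = {x. \<forall>y. h x \<le> h y}"

text \<open>Lipschitz differentiability forces finite values on the whole space and continuity, so
  "proper" and "closed" hold automatically for these real-valued functions.\<close>

definition admissible_objective :: "real \<Rightarrow> ('a::euclidean_space \<Rightarrow> real) \<Rightarrow> bool" where
  "admissible_objective L h \<longleftrightarrow>
     convex_on UNIV h \<and> bdd_below (range h) \<and>
     (\<forall>x. h differentiable (at x)) \<and> 0 < L \<and> L-lipschitz_on UNIV (grad h)"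

definition favg :: "('n::finite \<Rightarrow> 'a \<Rightarrow> real) \<Rightarrow> 'a \<Rightarrow> real" where
  "favg f x = (\<Sum>i\<in>UNIV. f i x) / real CARD('n)"

definition Lmax :: "('n::finite \<Rightarrow> real) \<Rightarrow> real" where
  "Lmax L = Max (range L)"

definition Lavg :: "('n::finite \<Rightarrow> real) \<Rightarrow> real" where
  "Lavg L = (\<Sum>i\<in>UNIV. L i) / real CARD('n)"

text \<open>The sum of the individual optimal values.  A convex function that is bounded below need not
  attain its infimum, so infima are used; where minimizers exist, this is the sum of the values
  at them, as the lemma states.\<close>

definition fopt_sum :: "('n::finite \<Rightarrow> 'a \<Rightarrow> real) \<Rightarrow> real" where
  "fopt_sum f = (\<Sum>i\<in>UNIV. INF x. f i x)"

lemma fopt_sum_eq: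
  assumes "\<And>i. xo i \<in> minimizers (f i)"
  shows "fopt_sum f = (\<Sum>i\<in>UNIV. f i (xo i))"
proof -
  have "(INF x. f i x) = f i (xo i)" for i
    using assms[of i] unfolding minimizers_def by (intro cInf_eq_minimum) auto
  then show ?thesis
    unfolding fopt_sum_def by simp
qed

definition Dconst :: "('n::finite \<Rightarrow> real) \<Rightarrow> ('n \<Rightarrow> 'a::zero \<Rightarrow> real) \<Rightarrow> real" where
  "Dconst L f = sqrt (2 * Lmax L * ((\<Sum>i\<in>UNIV. f i 0) - fopt_sum f))"


subsection \<open>Network and mixing matrix\<close>

definition connected_network :: "('n \<times> 'n) set \<Rightarrow> bool" where
  "connected_network E \<longleftrightarrow> sym E \<and> (\<forall>i j. (i, j) \<in> E\<^sup>*)"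

definition doubly_stochastic :: "real^'n^'n \<Rightarrow> bool" where
  "doubly_stochastic W \<longleftrightarrow>
     (\<forall>i j. 0 \<le> W $ i $ j) \<and> (\<forall>i. (\<Sum>j\<in>UNIV. W $ i $ j) = 1) \<and> (\<forall>j. (\<Sum>i\<in>UNIV. W $ i $ j) = 1)"

text \<open>The numbers \<open>lam 1 \<ge> \<dots> \<ge> lam n\<close> are the eigenvalues of the matrix, repeated according
  to their multiplicity as roots of the characteristic polynomial.\<close>

definition ordered_eigenvalues :: "real^'n^'n \<Rightarrow> (nat \<Rightarrow> real) \<Rightarrow> bool" where
  "ordered_eigenvalues W lam \<longleftrightarrow>
     (\<forall>t. det (mat t - W) = (\<Prod>i=1..CARD('n). t - lam i)) \<and>
     (\<forall>i j. 1 \<le> i \<and> i \<le> j \<and> j \<le> CARD('n) \<longrightarrow> lam j \<le> lam i)"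

definition beta :: "nat \<Rightarrow> (nat \<Rightarrow> real) \<Rightarrow> real" where
  "beta n lam = max \<bar>lam 2\<bar> \<bar>lam n\<bar>"

definition mixing_matrix :: "('n \<times> 'n) set \<Rightarrow> real^'n^'n \<Rightarrow> (nat \<Rightarrow> real) \<Rightarrow> bool" where
  "mixing_matrix E W lam \<longleftrightarrow>
     (\<forall>i j. i \<noteq> j \<and> (i, j) \<notin> E \<longrightarrow> W $ i $ j = 0) \<and>
     transpose W = W \<and> doubly_stochastic W \<and>
     ordered_eigenvalues W lam \<and> lam 1 = 1 \<and> - 1 \<le> lam CARD('n) \<and> beta CARD('n) lam < 1"


subsection \<open>Decentralized gradient descent\<close>

primrec dgd :: "real^'n^'n \<Rightarrow> real \<Rightarrow> ('n \<Rightarrow> 'a::euclidean_space \<Rightarrow> real) \<Rightarrow> nat \<Rightarrow> 'n \<Rightarrow> 'a" where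
  "dgd W \<alpha> f 0 = (\<lambda>i. 0)"
| "dgd W \<alpha> f (Suc k) = (\<lambda>i. (\<Sum>j\<in>UNIV. (W $ i $ j) *\<^sub>R dgd W \<alpha> f k j)
                                - \<alpha> *\<^sub>R grad (f i) (dgd W \<alpha> f k i))"

definition dgd_mean :: "real^'n^'n \<Rightarrow> real \<Rightarrow> ('n \<Rightarrow> 'a::euclidean_space \<Rightarrow> real) \<Rightarrow> nat \<Rightarrow> 'a" where
  "dgd_mean W \<alpha> f k = (1 / real CARD('n)) *\<^sub>R (\<Sum>i\<in>UNIV. dgd W \<alpha> f k i)"

definition admissible_step :: "('n::finite \<Rightarrow> real) \<Rightarrow> (nat \<Rightarrow> real) \<Rightarrow> real \<Rightarrow> bool" where
  "admissible_step L lam \<alpha> \<longleftrightarrow>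
     0 < \<alpha> \<and> \<alpha> \<le> min ((1 + lam CARD('n)) / Lmax L) (1 / Lavg L)"

text \<open>The error sequence decreases at the rate \<open>c / k\<close> for as long as it has not reached the
  level \<open>\<epsilon>\<close>.\<close>

definition sublinear_until :: "real \<Rightarrow> real \<Rightarrow> (nat \<Rightarrow> real) \<Rightarrow> bool" where
  "sublinear_until c \<epsilon> e \<longleftrightarrow> (\<forall>k\<ge>1. (\<forall>s\<le>k. \<epsilon> < e s) \<longrightarrow> e k \<le> c / real k)"

end

(* Decentralized gradient descent is gradient descent with unit step on the energy
     1/2 <x, (I - W) x> + alpha * (sum of f_i(x_i)),
   whose gradient has Lipschitz constant at most 2 because alpha * L_h <= 1 + lambda_n. As the
   energy never increases, L_h (1 - beta) |x - xbar|^2 + alpha |G|^2 <= alpha D^2, where G stacks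
   the gradients of the f_i at the agents' own iterates; moreover |x - xbar| <= alpha D / (1 - beta),
   since W contracts mean-zero vectors by the factor beta.

   The last inequality of the chain involves the gradients of f_j at the iterate of another agent i,
   which D does not bound directly. They are at most |G_j| + L_h |x_i - x_j|; the energy
   estimate pays for the second part, and the factor sqrt (1 - 1/n) gained from
   |x_i - xbar|^2 <= (1 - 1/n) |x - xbar|^2 makes up for the sum of both parts.

   For the rate, the mean iterate performs an inexact gradient step, so the squared distance to
   the minimizer telescopes up to an error O(alpha / (1 - beta)). Above that level the distance and
   the objective error both decrease, so k times the last error is at most the telescoped sum. *)

theory Submission
  imports Defs
begin

subsection \<open>Spectral bounds for the mixing matrix\<close>

text \<open>Rayleigh's principle: \<open>v\<close> maximizes \<open>x \<bullet> S x\<close> over the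
  unit sphere of \<open>V\<close>. The residual \<open>w = S v - \<mu> v\<close> stays in
  \<open>V\<close>, and unless it vanished, a small move of \<open>v\<close> along \<open>w\<close>
  would violate the maximality.\<close>

lemma selfadjoint_extremal_eigenvector:
  fixes S :: "'a::euclidean_space \<Rightarrow> 'a"
  assumes lin: "linear S" and sym: "\<And>x y. S x \<bullet> y = x \<bullet> S y"
    and V: "subspace V" and inv: "\<And>x. x \<in> V \<Longrightarrow> S x \<in> V" and nz: "y \<in> V" "y \<noteq> 0"
  obtains v \<mu> where "v \<in> V" "v \<noteq> 0" "S v = \<mu> *\<^sub>R v" "\<And>x. x \<in> V \<Longrightarrow> x \<bullet> S x \<le> \<mu> * (norm x)\<^sup>2"
proof -
  let ?K = "sphere 0 1 \<inter> V"
  have "compact ?K"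
    using V by (simp add: closed_subspace compact_Int_closed)
  moreover have "y /\<^sub>R norm y \<in> ?K"
    using nz V by (simp add: subspace_scale)
  hence "?K \<noteq> {}" by blast
  moreover have "continuous_on ?K (\<lambda>x. x \<bullet> S x)"
    by (intro continuous_intros linear_continuous_on lin linear_linear[THEN iffD2])
  ultimately obtain v where v: "v \<in> ?K" and vmax: "\<And>x. x \<in> ?K \<Longrightarrow> x \<bullet> S x \<le> v \<bullet> S v"
    using continuous_attains_sup[of ?K "\<lambda>x. x \<bullet> S x"] by blast
  define \<mu> where "\<mu> = v \<bullet> S v"
  have vv: "v \<bullet> v = 1" using v by (simp add: norm_eq_1)
  have bound: "x \<bullet> S x \<le> \<mu> * (norm x)\<^sup>2" if x: "x \<in> V" for x
  proof (cases "x = 0")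
    case False
    have "x /\<^sub>R norm x \<in> ?K" using x False V by (simp add: subspace_scale)
    from vmax[OF this] have "(inverse (norm x))\<^sup>2 * (x \<bullet> S x) \<le> \<mu>"
      by (simp add: linear_cmul[OF lin] \<mu>_def power2_eq_square)
    then show ?thesis using False by (simp add: field_simps)
  qed (simp add: linear_0[OF lin])
  define w where "w = S v - \<mu> *\<^sub>R v"
  have wV: "w \<in> V" unfolding w_def using v V inv by (simp add: subspace_diff subspace_scale)
  \<comment> \<open>The gap \<open>\<mu> |x|^2 - x \<bullet> S x\<close> at
    \<open>x = v + t w\<close> is \<open>t^2 c - 2 t (w \<bullet> w)\<close>. It is nonnegative for
    every \<open>t\<close>, so its linear term must vanish.\<close>
  define c where "c = \<mu> * (w \<bullet> w) - w \<bullet> S w"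
  have quad: "0 \<le> t\<^sup>2 * c - 2 * t * (w \<bullet> w)" for t
  proof -
    have "v + t *\<^sub>R w \<in> V" using v wV V by (simp add: subspace_add subspace_scale)
    from bound[OF this] have "0 \<le> \<mu> * ((v + t *\<^sub>R w) \<bullet> (v + t *\<^sub>R w)) - (v + t *\<^sub>R w) \<bullet> S (v + t *\<^sub>R w)"
      by (simp add: dot_square_norm)
    also have "\<dots> = \<mu> * (v \<bullet> v + 2 * t * (v \<bullet> w) + t\<^sup>2 * (w \<bullet> w))
        - (v \<bullet> S v + t * (v \<bullet> S w) + t * (w \<bullet> S v) + t\<^sup>2 * (w \<bullet> S w))"
      by (simp add: linear_add[OF lin] linear_cmul[OF lin] inner_add_left inner_add_right
          inner_commute power2_eq_square algebra_simps)
    also have "v \<bullet> S w = w \<bullet> S v" using sym[of v w] by (simp add: inner_commute)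
    also have "w \<bullet> S v = w \<bullet> w + \<mu> * (w \<bullet> v)"
      unfolding w_def by (simp add: inner_diff_right inner_diff_left algebra_simps inner_commute)
    finally show ?thesis unfolding c_def using vv
      by (simp add: \<mu>_def[symmetric] algebra_simps inner_commute)
  qed
  have "w \<bullet> w \<le> 0"
  proof (rule ccontr)
    assume "\<not> ?thesis"
    hence a: "0 < w \<bullet> w" by (simp only: not_le)
    \<comment> \<open>Small enough that the quadratic term is at most half of the linear one; the
      summand 1 keeps the denominator positive when \<open>c = 0\<close>.\<close>
    define t where "t = (w \<bullet> w) / (\<bar>c\<bar> + 1)"
    have t: "t > 0" unfolding t_def using a by (simp add: add_nonneg_pos)
    have "t * c \<le> t * (\<bar>c\<bar> + 1)" using t by simp
    also have "\<dots> = w \<bullet> w" unfolding t_def using abs_ge_zero[of c] by (simp add: field_simps)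
    finally have "t * (t * c) \<le> t * (w \<bullet> w)" using t by simp
    moreover have "0 < t * (w \<bullet> w)" using t a by simp
    ultimately show False using quad[of t] by (simp add: power2_eq_square)
  qed
  hence "w = 0" by (metis inner_ge_zero inner_eq_zero_iff order_antisym)
  hence "S v = \<mu> *\<^sub>R v" by (simp add: w_def)
  moreover have "v \<noteq> 0" using vv by auto
  ultimately show thesis using that v bound by blast
qed

section \<open>Eigenvectors of \<open>W\<close> and roots of its characteristic polynomial\<close>

lemma det_eigenvalue_eq_0:
  fixes W :: "real^'n^'n"
  assumes "W *v y = \<mu> *\<^sub>R y" "y \<noteq> 0"
  shows "det (mat \<mu> - W) = 0"
proof (rule ccontr)
  assume "\<not> ?thesis"
  hence "invertible (mat \<mu> - W)" by (simp add: invertible_det_nz)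
  then obtain B where "B ** (mat \<mu> - W) = mat 1" unfolding invertible_def by blast
  moreover have "(mat \<mu> - W) *v y = 0"
  proof -
    have "mat \<mu> *v y = \<mu> *\<^sub>R y"
      by (simp add: vec_eq_iff matrix_vector_mult_def mat_def if_distrib if_distribR cong: if_cong)
    thus ?thesis using assms by (simp add: matrix_vector_mult_diff_rdistrib)
  qed
  ultimately show False using assms(2) matrix_left_invertible_ker by blast
qed

text \<open>A two-dimensional eigenspace gives a double root of the characteristic polynomial, stated
  with a continuous cofactor; two rows are replaced by the eigenvectors by Cramer's rule.\<close>

lemma det_two_eigenvectors:
  fixes W :: "real^'n^'n"
  assumes sym: "transpose W = W"
    and u: "W *v u = \<mu> *\<^sub>R u" and y: "W *v y = \<mu> *\<^sub>R y"
    and yk: "y $ k \<noteq> 0" and ind: "u $ j * y $ k \<noteq> u $ k * y $ j"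
  obtains c where "continuous_on UNIV c" "\<And>t. det (mat t - W) = (t - \<mu>)\<^sup>2 * c t"
proof -
  have jk: "j \<noteq> k" using ind by auto
  \<comment> \<open>Coefficients that still combine the rows to \<open>(t - \<mu>) u\<close> once
    row \<open>k\<close> has been replaced by \<open>(t - \<mu>) y\<close>: the share
    \<open>z $ k\<close> of that row is subtracted from the others. Independence of \<open>u\<close>
    and \<open>y\<close> is what makes \<open>z $ j\<close> nonzero.\<close>
  define z where "z = (\<chi> i. if i = k then u $ k / y $ k else u $ i - u $ k * y $ i / y $ k)"
  have zj: "z $ j \<noteq> 0" using jk ind yk by (simp add: z_def field_simps)
  define M where "M = (\<lambda>t. (\<chi> i. if i = j then u else if i = k then y else row i (mat t - W)))"
  define d where "d = (\<lambda>t. det (M t))"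
  have *: "z $ j * (y $ k * det (mat t - W)) = (t - \<mu>)\<^sup>2 * d t" for t
  proof -
    let ?A = "mat t - W"
    \<comment> \<open>By symmetry of \<open>W\<close>, combining rows with the entries of an
      eigenvector is the same as applying the matrix to it.\<close>
    have comb: "(\<Sum>i\<in>UNIV. x $ i *s row i ?A) = (t - \<mu>) *s x" if "W *v x = \<mu> *\<^sub>R x" for x
    proof -
      have "(\<Sum>i\<in>UNIV. x $ i *s row i ?A) = transpose ?A *v x"
        by (simp add: vec_eq_iff matrix_vector_mult_def row_def transpose_def mult.commute)
      also have "transpose ?A = mat t - transpose W"
        by (auto simp: vec_eq_iff transpose_def mat_def)
      also have "(mat t - transpose W) *v x = mat t *v x - W *v x"
        by (simp add: sym matrix_vector_mult_diff_rdistrib)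
      also have "mat t *v x = t *\<^sub>R x"
        by (simp add: vec_eq_iff matrix_vector_mult_def mat_def if_distrib if_distribR cong: if_cong)
      finally show ?thesis using that by (simp add: scalar_mult_eq_scaleR scaleR_left_diff_distrib)
    qed
    \<comment> \<open>Replacing row \<open>k\<close> by the combination with coefficients
      \<open>y\<close> multiplies the determinant by \<open>y $ k\<close> and exposes one factor
      \<open>t - \<mu>\<close>; row \<open>j\<close> below yields the second.\<close>
    let ?A1 = "\<chi> i. if i = k then (t - \<mu>) *s y else row i ?A"
    have d1: "det ?A1 = y $ k * det ?A"
      using cramer_lemma_transpose[of k y ?A] unfolding comb[OF y] .
    have r: "row i ?A1 = (if i = k then (t - \<mu>) *s y else row i ?A)" for i
      by (simp add: row_def vec_eq_iff)
    have "(\<Sum>i\<in>UNIV. z $ i *s row i ?A1)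
        = z $ k *s ((t - \<mu>) *s y) + (\<Sum>i\<in>UNIV-{k}. z $ i *s row i ?A)"
      by (subst sum.remove[of _ k]) (auto simp: r intro!: sum.cong)
    also have "(\<Sum>i\<in>UNIV-{k}. z $ i *s row i ?A)
        = (\<Sum>i\<in>UNIV-{k}. (u $ i - z $ k * y $ i) *s row i ?A)"
      by (rule sum.cong) (auto simp: z_def)
    also have "\<dots> = (\<Sum>i\<in>UNIV. (u $ i - z $ k * y $ i) *s row i ?A)"
      by (subst (2) sum.remove[of _ k]) (use yk in \<open>auto simp: z_def\<close>)
    also have "\<dots> = (\<Sum>i\<in>UNIV. u $ i *s row i ?A) - z $ k *s (\<Sum>i\<in>UNIV. y $ i *s row i ?A)"
      by (simp add: vec_eq_iff sum_subtractf sum_distrib_left algebra_simps)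
    also have "\<dots> = (t - \<mu>) *s u - z $ k *s ((t - \<mu>) *s y)"
      by (simp add: comb[OF y] comb[OF u])
    finally have s: "(\<Sum>i\<in>UNIV. z $ i *s row i ?A1) = (t - \<mu>) *s u" by simp
    let ?A2 = "\<chi> i. if i = j then (t - \<mu>) *s u else if i = k then (t - \<mu>) *s y else row i ?A"
    have "det ?A2 = z $ j * det ?A1"
      using cramer_lemma_transpose[of j z ?A1] unfolding s unfolding r .
    moreover have "det ?A2 = (t - \<mu>) * det (\<chi> i. if i = j then u else if i = k then (t - \<mu>) *s y else row i ?A)"
      using det_row_mul[of j "t - \<mu>" "\<lambda>_. u" "\<lambda>i. if i = k then (t - \<mu>) *s y else row i ?A"] by simp
    moreover have "(\<chi> i. if i = j then u else if i = k then (t - \<mu>) *s y else row i ?A)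
       = (\<chi> i. if i = k then (t - \<mu>) *s y else if i = j then u else row i ?A)"
      using jk by (auto simp: vec_eq_iff)
    moreover have "det (\<chi> i. if i = k then (t - \<mu>) *s y else if i = j then u else row i ?A)
      = (t - \<mu>) * det (\<chi> i. if i = k then y else if i = j then u else row i ?A)"
      by (rule det_row_mul)
    moreover have "(\<chi> i. if i = k then y else if i = j then u else row i ?A) = M t"
      using jk by (auto simp: vec_eq_iff M_def)
    ultimately show ?thesis using d1 by (simp add: d_def power2_eq_square)
  qed
  have "continuous_on UNIV (\<lambda>t. M t $ a $ b)" for a b
    unfolding M_def row_def mat_def
    by (cases "a = j"; cases "a = k"; cases "a = b") (auto intro!: continuous_intros)
  hence "continuous_on UNIV d"
    unfolding d_def det_def
    by (intro continuous_on_sum continuous_on_mult continuous_on_prod continuous_on_const)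
  show thesis
  proof (rule that[of "\<lambda>t. d t / (z $ j * y $ k)"])
    show "continuous_on UNIV (\<lambda>t. d t / (z $ j * y $ k))"
      using \<open>continuous_on UNIV d\<close> zj yk by (intro continuous_intros) auto
    show "det (mat t - W) = (t - \<mu>)\<^sup>2 * (d t / (z $ j * y $ k))" for t
      using *[of t] zj yk by (simp add: field_simps)
  qed
qed

text \<open>The bound covers \<open>lam 2\<close>, ..., \<open>lam n\<close> only, so
  \<open>\<mu>\<close> has to be found among these. If \<open>\<mu>\<close> differs from 1, the
  factor \<open>t - 1\<close> can be discarded. If \<open>\<mu> = 1\<close>, then \<open>y\<close>
  and the all-ones vector are independent eigenvectors, 1 is a double root, and some further
  \<open>lam i\<close> equals 1.\<close>

lemma mixing_matrix_mean_zero_eigenvalue: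
  fixes W :: "real^'n^'n"
  assumes n: "2 \<le> CARD('n)" and mix: "mixing_matrix E W lam"
    and eig: "W *v y = \<mu> *\<^sub>R y" and y0: "y \<noteq> 0" and mean: "(\<Sum>i\<in>UNIV. y $ i) = 0"
  shows "\<bar>\<mu>\<bar> \<le> beta CARD('n) lam"
proof -
  have sym: "transpose W = W" and W1: "\<And>i. (\<Sum>j\<in>UNIV. W $ i $ j) = 1"
    and char: "\<And>t. det (mat t - W) = (\<Prod>i=1..CARD('n). t - lam i)"
    and mono: "\<And>i j. 1 \<le> i \<Longrightarrow> i \<le> j \<Longrightarrow> j \<le> CARD('n) \<Longrightarrow> lam j \<le> lam i"
    and l1: "lam 1 = 1"
    using mix by (auto simp: mixing_matrix_def ordered_eigenvalues_def doubly_stochastic_def)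
  have split: "{1..CARD('n)} = insert 1 {2..CARD('n)}" using n by auto
  have char': "det (mat t - W) = (t - 1) * (\<Prod>i=2..CARD('n). t - lam i)" for t
    unfolding char split using l1 by simp
  have "\<exists>i\<in>{2..CARD('n)}. lam i = \<mu>"
  proof (cases "\<mu> = 1")
    case False
    then show ?thesis
      using det_eigenvalue_eq_0[OF eig y0] unfolding char' by auto
  next
    case True
    obtain k where k: "y $ k \<noteq> 0" using y0 by (auto simp: vec_eq_iff)
    have "\<exists>j. y $ j \<noteq> y $ k"
    proof (rule ccontr)
      assume "\<not> ?thesis"
      hence "(\<Sum>i\<in>UNIV. y $ i) = (\<Sum>i\<in>(UNIV::'n set). y $ k)" by (intro sum.cong) auto
      with mean k show False by simp
    qed
    then obtain j where j: "y $ j \<noteq> y $ k" by blast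
    have one: "W *v (\<chi> i. 1) = \<mu> *\<^sub>R (\<chi> i. 1)"
      by (simp add: vec_eq_iff matrix_vector_mult_def W1 True)
    obtain c where c: "continuous_on UNIV c" "\<And>t. det (mat t - W) = (t - \<mu>)\<^sup>2 * c t"
      by (rule det_two_eigenvectors[OF sym one eig k, of j]) (use j in auto)
    let ?q = "\<lambda>t. \<Prod>i=2..CARD('n). t - lam i"
    \<comment> \<open>One factor \<open>t - 1\<close> can be cancelled only away from 1; the value
      of the remaining product at 1 is then recovered as a limit, which is where continuity of
      \<open>c\<close> enters.\<close>
    have "?q t = (t - 1) * c t" if "t \<noteq> 1" for t
      using char'[of t] c(2)[of t] that by (simp add: True power2_eq_square)
    hence ev: "\<forall>\<^sub>F t in at 1. (t - 1) * c t = ?q t" 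
      by (auto simp: eventually_at_filter)
    have "isCont c 1" using c(1) continuous_on_eq_continuous_at by blast
    hence "((\<lambda>t. (t - 1) * c t) \<longlongrightarrow> (1 - 1) * c 1) (at 1)"
      by (intro tendsto_intros) (auto simp: isCont_def)
    hence "(?q \<longlongrightarrow> 0) (at 1)" using Lim_transform_eventually[OF _ ev] by simp
    moreover have "(?q \<longlongrightarrow> ?q 1) (at 1)" by (intro tendsto_intros)
    ultimately have "?q 1 = 0" using tendsto_unique[OF trivial_limit_at] by blast
    thus ?thesis using True by auto
  qed
  then obtain i where "2 \<le> i" "i \<le> CARD('n)" "lam i = \<mu>" by auto
  with mono[of 2 i] mono[of i "CARD('n)"] show ?thesis unfolding beta_def by auto
qed

lemma ordered_eigenvalues_least:
  fixes W :: "real^'n^'n"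
  assumes "ordered_eigenvalues W lam" "W *v y = \<mu> *\<^sub>R y" "y \<noteq> 0"
  shows "lam CARD('n) \<le> \<mu>"
  using det_eigenvalue_eq_0[OF assms(2,3)] assms(1) unfolding ordered_eigenvalues_def by force

section \<open>Stacked agent vectors: the Kronecker product of \<open>W\<close> with the identity,
  the mean, and the deviation from it\<close>

definition mix :: "real^'n^'n \<Rightarrow> 'a::euclidean_space^'n \<Rightarrow> 'a^'n" where
  "mix W X = (\<chi> i. \<Sum>j\<in>UNIV. W $ i $ j *\<^sub>R X $ j)"

definition vmean :: "'a::euclidean_space^'n \<Rightarrow> 'a" where
  "vmean X = (1 / real CARD('n)) *\<^sub>R (\<Sum>i\<in>UNIV. X $ i)"

text \<open>The orthogonal projection onto the stacks with sum zero, the complement of the consensus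
  stacks.\<close>

definition dev :: "'a::euclidean_space^'n \<Rightarrow> 'a^'n" where
  "dev X = X - (\<chi> i. vmean X)"

lemma power2_norm_vec: "(norm X)\<^sup>2 = (\<Sum>i\<in>UNIV. (norm (X $ i))\<^sup>2)"
  for X :: "'a::real_inner^'n"
  by (simp add: power2_norm_eq_inner inner_vec_def)

lemma sum_dev [simp]: "(\<Sum>i\<in>UNIV. dev X $ i) = 0"
  by (simp add: dev_def vmean_def sum_subtractf sum_constant_scaleR)

lemma linear_vmean: "linear vmean"
  by (rule linearI) (simp_all add: vmean_def sum.distrib scaleR_right_distrib scaleR_left_commute
      flip: scaleR_sum_right)

lemma linear_dev: "linear dev"
  by (rule linearI) (simp_all add: dev_def vec_eq_iff linear_add[OF linear_vmean]
      linear_cmul[OF linear_vmean] scaleR_right_diff_distrib)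

lemma norm_dev_le: "norm (dev X) \<le> norm X"
proof -
  have "dev X \<bullet> (\<chi> i. vmean X) = (\<Sum>i\<in>UNIV. dev X $ i) \<bullet> vmean X"
    by (simp only: inner_vec_def inner_sum_left vec_lambda_beta)
  hence "dev X \<bullet> (\<chi> i. vmean X) = 0" by simp
  moreover have "X = dev X + (\<chi> i. vmean X)" by (simp add: dev_def)
  ultimately have "(norm X)\<^sup>2 = (norm (dev X))\<^sup>2 + (norm ((\<chi> i. vmean X) :: 'a^'b))\<^sup>2"
    by (metis norm_add_Pythagorean orthogonal_def)
  hence "(norm (dev X))\<^sup>2 \<le> (norm X)\<^sup>2" by simp
  thus ?thesis by (rule power2_le_imp_le) simp
qed

lemma linear_mix: "linear (mix W)"
  by (rule linearI) (simp_all add: mix_def vec_eq_iff sum.distrib scaleR_right_distrib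
      scaleR_sum_right mult.commute)

lemma mix_selfadjoint:
  assumes "transpose W = W"
  shows "mix W X \<bullet> Y = X \<bullet> mix W Y"
proof -
  have W: "W $ i $ j = W $ j $ i" for i j
    by (subst assms[symmetric]) (simp add: transpose_def)
  have "mix W X \<bullet> Y = (\<Sum>i\<in>UNIV. \<Sum>j\<in>UNIV. W $ i $ j * (X $ j \<bullet> Y $ i))"
    by (simp add: mix_def inner_vec_def inner_sum_left)
  also have "\<dots> = (\<Sum>j\<in>UNIV. \<Sum>i\<in>UNIV. W $ j $ i * (X $ j \<bullet> Y $ i))"
    by (subst sum.swap) (intro sum.cong refl arg_cong2[where f = "(*)"] W)
  also have "\<dots> = X \<bullet> mix W Y"
    by (simp add: mix_def inner_vec_def inner_sum_right)
  finally show ?thesis .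
qed

lemma doubly_stochastic_sum_mix:
  assumes "doubly_stochastic W"
  shows "(\<Sum>i\<in>UNIV. mix W X $ i) = (\<Sum>i\<in>UNIV. X $ i)"
proof -
  have "(\<Sum>i\<in>UNIV. mix W X $ i) = (\<Sum>j\<in>UNIV. \<Sum>i\<in>UNIV. W $ i $ j *\<^sub>R X $ j)"
    by (simp add: mix_def) (rule sum.swap)
  also have "\<dots> = (\<Sum>j\<in>UNIV. (\<Sum>i\<in>UNIV. W $ i $ j) *\<^sub>R X $ j)"
    by (simp add: scaleR_left.sum)
  finally show ?thesis using assms by (simp add: doubly_stochastic_def)
qed

lemma doubly_stochastic_mix_const:
  assumes "doubly_stochastic W"
  shows "mix W (\<chi> i. c) = (\<chi> i. c)"
  using assms by (simp add: mix_def doubly_stochastic_def vec_eq_iff flip: scaleR_left.sum)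

lemma dev_mix:
  assumes "doubly_stochastic W"
  shows "dev (mix W X) = mix W (dev X)"
  by (simp add: dev_def linear_diff[OF linear_mix] doubly_stochastic_mix_const[OF assms]
      vmean_def doubly_stochastic_sum_mix[OF assms])

text \<open>Eigenvalue facts about \<open>W\<close> transfer to \<open>mix W\<close> by reading off
  one coordinate: along a basis vector \<open>b\<close> where \<open>X\<close> does not vanish, the
  entries form a scalar eigenvector.\<close>

lemma mix_eigenvector:
  fixes X :: "'a::euclidean_space^'n"
  assumes "mix W X = \<mu> *\<^sub>R X" "X \<noteq> 0"
  obtains y where "W *v y = \<mu> *\<^sub>R y" "y \<noteq> 0" "(\<Sum>i\<in>UNIV. X $ i) = 0 \<Longrightarrow> (\<Sum>i\<in>UNIV. y $ i) = 0"
proof -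
  obtain i where "X $ i \<noteq> 0" using assms(2) by (auto simp: vec_eq_iff)
  then obtain b where b: "X $ i \<bullet> b \<noteq> 0" "b \<in> Basis" using euclidean_all_zero_iff by blast
  define y where "y = (\<chi> i. X $ i \<bullet> b)"
  have "(W *v y) $ i = (mix W X) $ i \<bullet> b" for i
    by (simp add: matrix_vector_mult_def y_def mix_def inner_sum_left)
  hence "W *v y = \<mu> *\<^sub>R y" using assms(1) by (simp add: vec_eq_iff y_def)
  moreover have "y \<noteq> 0" using b by (auto simp: y_def vec_eq_iff)
  moreover have "(\<Sum>i\<in>UNIV. y $ i) = (\<Sum>i\<in>UNIV. X $ i) \<bullet> b"
    by (simp add: y_def inner_sum_left)
  ultimately show thesis using that by simp
qed

text \<open>The extremal principle controls a quadratic form from above, not a norm. It is therefore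
  applied to the square of \<open>mix W\<close> on the mean-zero stacks, since
  \<open>Y \<bullet> mix W (mix W Y)\<close> is the squared norm of \<open>mix W Y\<close>.\<close>

lemma mixing_matrix_contraction:
  fixes X :: "'a::euclidean_space^'n"
  assumes n: "2 \<le> CARD('n)" and mm: "mixing_matrix E W lam" and X: "(\<Sum>i\<in>UNIV. X $ i) = 0"
  shows "norm (mix W X) \<le> beta CARD('n) lam * norm X"
proof (cases "X = 0")
  case True
  then show ?thesis by (simp add: linear_0[OF linear_mix])
next
  case False
  let ?V = "{X::'a^'n. (\<Sum>i\<in>UNIV. X $ i) = 0}"
  have sym: "transpose W = W" and ds: "doubly_stochastic W" using mm by (auto simp: mixing_matrix_def)
  note sa = mix_selfadjoint[OF sym]
  note add = linear_add[OF linear_mix] and cmul = linear_cmul[OF linear_mix]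
  have V: "subspace ?V"
    by (auto simp: subspace_def sum.distrib simp flip: scaleR_sum_right)
  have inv: "mix W Y \<in> ?V" if "Y \<in> ?V" for Y :: "'a^'n"
    using that by (simp add: doubly_stochastic_sum_mix[OF ds])
  have "linear (\<lambda>Y::'a^'n. mix W (mix W Y))"
    using linear_compose[OF linear_mix linear_mix] by (simp add: o_def)
  moreover have "mix W (mix W Y) \<bullet> Z = Y \<bullet> mix W (mix W Z)" for Y Z :: "'a^'n"
    by (simp add: sa)
  ultimately obtain v \<mu> where v: "v \<in> ?V" "v \<noteq> 0" "mix W (mix W v) = \<mu> *\<^sub>R v"
    and bd: "\<And>Y. Y \<in> ?V \<Longrightarrow> Y \<bullet> mix W (mix W Y) \<le> \<mu> * (norm Y)\<^sup>2"
    using selfadjoint_extremal_eigenvector[of "\<lambda>Y. mix W (mix W Y)" ?V X] V inv X False by blast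
  have nsq: "Y \<bullet> mix W (mix W Y) = (norm (mix W Y))\<^sup>2" for Y :: "'a^'n"
    by (simp add: sa[symmetric] dot_square_norm)
  have "0 \<le> \<mu> * (norm v)\<^sup>2" using bd[OF v(1)] nsq[of v] by (metis order_trans zero_le_power2)
  hence "0 \<le> \<mu>" using v(2) by (simp add: zero_le_mult_iff)
  define m where "m = sqrt \<mu>"
  have m: "0 \<le> m" "m * m = \<mu>" using \<open>0 \<le> \<mu>\<close> by (auto simp: m_def)
  have eig: "\<bar>\<nu>\<bar> \<le> beta CARD('n) lam" if "mix W u = \<nu> *\<^sub>R u" "u \<noteq> 0" "u \<in> ?V" for \<nu> and u :: "'a^'n"
    using mix_eigenvector[OF that(1,2)] mixing_matrix_mean_zero_eigenvalue[OF n mm] that(3)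
    by (metis (mono_tags, lifting) mem_Collect_eq)
  \<comment> \<open>From \<open>(mix W - m) (mix W + m) v = 0\<close>: either \<open>v\<close> has
    eigenvalue \<open>- m\<close>, or \<open>mix W v + m v\<close> is an eigenvector for
    \<open>m\<close>. Both are mean-zero, so \<open>m\<close> is bounded either way.\<close>
  have mb: "m \<le> beta CARD('n) lam"
  proof (cases "mix W v + m *\<^sub>R v = 0")
    case True
    hence "mix W v = (- m) *\<^sub>R v" by (simp add: eq_neg_iff_add_eq_0)
    from eig[OF this v(2,1)] show ?thesis by simp
  next
    case False
    have "mix W (mix W v + m *\<^sub>R v) = m *\<^sub>R (mix W v + m *\<^sub>R v)"
      by (simp add: add cmul v(3) m(2)[symmetric] algebra_simps)
    moreover have "mix W v + m *\<^sub>R v \<in> ?V" using inv[OF v(1)] v(1) by (intro subspace_add[OF V] subspace_scale[OF V])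
    ultimately show ?thesis using eig False by fastforce
  qed
  have "(m * norm X)\<^sup>2 = \<mu> * (norm X)\<^sup>2"
    by (simp add: power_mult_distrib power2_eq_square[of m] m(2))
  hence "(norm (mix W X))\<^sup>2 \<le> (m * norm X)\<^sup>2"
    using bd[of X] X nsq[of X] by simp
  hence "norm (mix W X) \<le> m * norm X" by (rule power2_le_imp_le) (simp add: m)
  also have "\<dots> \<le> beta CARD('n) lam * norm X" using mb by (simp add: mult_right_mono)
  finally show ?thesis .
qed

text \<open>The extremal principle for \<open>- mix W\<close> on the whole space: its largest
  eigenvalue is the negative of an eigenvalue of \<open>W\<close>, and that one is at least
  \<open>lam n\<close>.\<close>

lemma mixing_matrix_least_eigenvalue:
  fixes X :: "'a::euclidean_space^'n"
  assumes mm: "mixing_matrix E W lam"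
  shows "lam CARD('n) * (norm X)\<^sup>2 \<le> X \<bullet> mix W X"
proof (cases "X = 0")
  case False
  have sym: "transpose W = W" and oe: "ordered_eigenvalues W lam"
    using mm by (auto simp: mixing_matrix_def)
  have lin: "linear (\<lambda>Y::'a^'n. - mix W Y)" by (rule linear_compose_neg[OF linear_mix])
  have sa: "(- mix W Y) \<bullet> Z = Y \<bullet> (- mix W Z)" for Y Z :: "'a^'n"
    by (simp add: mix_selfadjoint[OF sym])
  obtain v \<mu> where "v \<in> (UNIV :: ('a^'n) set)" and v: "v \<noteq> 0" "- mix W v = \<mu> *\<^sub>R v"
    and bd: "\<And>Y::'a^'n. Y \<in> UNIV \<Longrightarrow> Y \<bullet> (- mix W Y) \<le> \<mu> * (norm Y)\<^sup>2"
    by (rule selfadjoint_extremal_eigenvector[OF lin sa subspace_UNIV UNIV_I UNIV_I False]) (rule that; simp)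
  have "mix W v = (- \<mu>) *\<^sub>R v"
    unfolding scaleR_minus_left v(2)[symmetric] by simp
  then obtain y where "W *v y = (- \<mu>) *\<^sub>R y" "y \<noteq> 0" using mix_eigenvector v(1) by blast
  from ordered_eigenvalues_least[OF oe this] have "lam CARD('n) * (norm X)\<^sup>2 \<le> - \<mu> * (norm X)\<^sup>2"
    by (rule mult_right_mono) simp
  with bd[of X] show ?thesis by simp
qed simp

subsection \<open>Smooth convex functions\<close>

text \<open>As \<open>grad\<close> is a definite description, existence and uniqueness are both
  required: \<open>d\<close> is the Riesz representative of the derivative, and any other candidate
  is compared with it in the direction of their difference.\<close>

lemma differentiable_imp_GDERIV_grad:
  fixes h :: "'a::euclidean_space \<Rightarrow> real"
  assumes "h differentiable (at x)"
  shows "GDERIV h x :> grad h x"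
proof -
  obtain D where D: "(h has_derivative D) (at x)" using assms by (auto simp: differentiable_def)
  have lin: "linear D" using D by (rule has_derivative_linear)
  define d where "d = (\<Sum>b\<in>Basis. D b *\<^sub>R b)"
  have "D v = v \<bullet> d" for v
  proof -
    have "D v = D (\<Sum>b\<in>Basis. (v \<bullet> b) *\<^sub>R b)" by (simp add: euclidean_representation)
    also have "\<dots> = (\<Sum>b\<in>Basis. (v \<bullet> b) * D b)"
      by (simp add: linear_sum[OF lin] linear_cmul[OF lin])
    also have "\<dots> = v \<bullet> d" by (simp add: d_def inner_sum_right mult.commute)
    finally show ?thesis .
  qed
  hence "GDERIV h x :> d" using D unfolding gderiv_def by (metis (no_types, lifting) has_derivative_transform ext)
  moreover have "d' = d" if "GDERIV h x :> d'" for d'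
  proof -
    have "(\<lambda>v. v \<bullet> d') = (\<lambda>v. v \<bullet> d)"
      using that \<open>GDERIV h x :> d\<close> unfolding gderiv_def by (rule has_derivative_unique)
    hence "(d' - d) \<bullet> d' = (d' - d) \<bullet> d" by metis
    hence "(d' - d) \<bullet> (d' - d) = 0" by (simp add: inner_diff_right)
    thus ?thesis by simp
  qed
  ultimately show ?thesis unfolding grad_def by (rule theI)
qed

lemma grad_eqI:
  assumes "GDERIV h x :> d"
  shows "grad h x = d"
proof -
  have "GDERIV h x :> grad h x"
    using assms by (intro differentiable_imp_GDERIV_grad) (auto simp: gderiv_def differentiable_def)
  hence "(\<lambda>v. v \<bullet> grad h x) = (\<lambda>v. v \<bullet> d)"
    using assms unfolding gderiv_def by (rule has_derivative_unique)
  hence "(grad h x - d) \<bullet> grad h x = (grad h x - d) \<bullet> d" by metis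
  hence "(grad h x - d) \<bullet> (grad h x - d) = 0" by (simp add: inner_diff_right)
  thus ?thesis by simp
qed

lemma GDERIV_along_line:
  assumes "GDERIV h (x + t *\<^sub>R d) :> g"
  shows "((\<lambda>t. h (x + t *\<^sub>R d)) has_real_derivative g \<bullet> d) (at t)"
proof -
  have "((\<lambda>t. x + t *\<^sub>R d) has_derivative (\<lambda>s. s *\<^sub>R d)) (at t)"
    by (auto intro!: derivative_eq_intros)
  from has_derivative_compose[OF this assms[unfolded gderiv_def]]
  show ?thesis by (simp add: has_field_derivative_def inner_commute mult_commute_abs)
qed

text \<open>Restriction to the line through \<open>x\<close> and \<open>y\<close> reduces this to
  the tangent inequality for a convex function of one real variable.\<close>

lemma convex_first_order_lower_bound:
  fixes h :: "'a::euclidean_space \<Rightarrow> real"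
  assumes cvx: "convex_on UNIV h" and g: "GDERIV h x :> g"
  shows "h x + g \<bullet> (y - x) \<le> h y"
proof -
  have "convex_on UNIV (\<lambda>t. h (x + t *\<^sub>R (y - x)))"
  proof (rule convex_onI)
    fix t a b :: real assume t: "0 < t" "t < 1"
    have "x + ((1 - t) *\<^sub>R a + t *\<^sub>R b) *\<^sub>R (y - x)
        = (1 - t) *\<^sub>R (x + a *\<^sub>R (y - x)) + t *\<^sub>R (x + b *\<^sub>R (y - x))"
      by (simp add: algebra_simps)
    thus "h (x + ((1 - t) *\<^sub>R a + t *\<^sub>R b) *\<^sub>R (y - x))
        \<le> (1 - t) * h (x + a *\<^sub>R (y - x)) + t * h (x + b *\<^sub>R (y - x))"
      using convex_onD[OF cvx, of t] t by simp
  qed simp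
  from convex_on_imp_above_tangent[OF this, of 0 1 "g \<bullet> (y - x)"]
    GDERIV_along_line[of h x 0 "y - x" g] g
  show ?thesis by simp
qed

lemma lipschitz_gradient_upper_bound:
  fixes h :: "'a::euclidean_space \<Rightarrow> real"
  assumes diff: "\<And>x. GDERIV h x :> g x" and lip: "L-lipschitz_on UNIV g"
  shows "h y \<le> h x + g x \<bullet> (y - x) + L / 2 * (norm (y - x))\<^sup>2"
proof -
  define d where "d = y - x"
  \<comment> \<open>The difference between \<open>h\<close> along the segment and the linear and
    quadratic terms of the bound. The Lipschitz condition makes its derivative nonpositive, so its
    values at 0 and 1 give the claim.\<close>
  define \<phi> where "\<phi> t = h (x + t *\<^sub>R d) - t * (g x \<bullet> d) - L * t\<^sup>2 / 2 * (norm d)\<^sup>2" for t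
  have "\<phi> 1 \<le> \<phi> 0"
  proof (rule DERIV_nonpos_imp_nonincreasing[of 0 1 \<phi>])
    fix t :: real assume t: "0 \<le> t" "t \<le> 1"
    have "(\<phi> has_real_derivative (g (x + t *\<^sub>R d) \<bullet> d - g x \<bullet> d - L * t * (norm d)\<^sup>2)) (at t)"
      unfolding \<phi>_def
      by (rule derivative_eq_intros GDERIV_along_line diff refl | simp)+
    moreover have "g (x + t *\<^sub>R d) \<bullet> d - g x \<bullet> d \<le> L * t * (norm d)\<^sup>2"
    proof -
      have "g (x + t *\<^sub>R d) \<bullet> d - g x \<bullet> d \<le> norm (g (x + t *\<^sub>R d) - g x) * norm d"
        by (metis inner_diff_left norm_cauchy_schwarz)
      also have "\<dots> \<le> (L * norm (t *\<^sub>R d)) * norm d"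
        using lipschitz_onD[OF lip, of "x + t *\<^sub>R d" x] by (intro mult_right_mono) (auto simp: dist_norm)
      finally show ?thesis using t by (simp add: power2_eq_square mult.assoc)
    qed
    ultimately show "\<exists>z. (\<phi> has_real_derivative z) (at t) \<and> z \<le> 0" by fastforce
  qed simp
  thus ?thesis by (simp add: \<phi>_def d_def)
qed

text \<open>A gradient step of length \<open>1 / L\<close> lowers \<open>h\<close> by at least
  \<open>|g x|^2 / (2 L)\<close> and cannot go below the infimum.\<close>

lemma grad_norm_bound:
  fixes h :: "'a::euclidean_space \<Rightarrow> real"
  assumes diff: "\<And>x. GDERIV h x :> g x" and lip: "L-lipschitz_on UNIV g"
    and L: "0 < L" and bdd: "bdd_below (range h)"
  shows "(norm (g x))\<^sup>2 \<le> 2 * L * (h x - (INF y. h y))"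
proof -
  let ?y = "x - (1 / L) *\<^sub>R g x"
  have "(INF y. h y) \<le> h ?y" using bdd by (intro cINF_lower) auto
  also have "h ?y \<le> h x - (1 / L) * (g x \<bullet> g x) + L / 2 * ((1 / L)\<^sup>2 * (g x \<bullet> g x))"
    using lipschitz_gradient_upper_bound[OF diff lip, of ?y x] L
    by (simp add: dot_square_norm power_mult_distrib power_divide)
  also have "\<dots> = h x - (norm (g x))\<^sup>2 / (2 * L)"
    using L by (simp add: dot_square_norm field_simps power2_eq_square)
  finally show ?thesis using L by (simp add: field_simps)
qed

lemma favg_GDERIV:
  fixes f :: "'n::finite \<Rightarrow> 'a::euclidean_space \<Rightarrow> real"
  assumes "\<And>i. GDERIV (f i) x :> g i"
  shows "GDERIV (favg f) x :> (1 / real CARD('n)) *\<^sub>R (\<Sum>i\<in>UNIV. g i)"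
proof -
  have "((\<lambda>x. (1 / real CARD('n)) *\<^sub>R (\<Sum>i\<in>UNIV. f i x)) has_derivative
     (\<lambda>v. (1 / real CARD('n)) *\<^sub>R (\<Sum>i\<in>UNIV. v \<bullet> g i))) (at x)"
    using assms unfolding gderiv_def by (intro has_derivative_scaleR_right has_derivative_sum)
  thus ?thesis unfolding gderiv_def favg_def by (simp add: inner_sum_right)
qed

lemma favg_convex:
  assumes "\<And>i. convex_on UNIV (f i)"
  shows "convex_on UNIV (favg f)"
proof (rule convex_onI)
  fix t :: real and x y :: 'b assume t: "0 < t" "t < 1"
  have "(\<Sum>i\<in>UNIV. f i ((1 - t) *\<^sub>R x + t *\<^sub>R y)) \<le> (\<Sum>i\<in>UNIV. (1 - t) * f i x + t * f i y)"
    using convex_onD[OF assms, of t] t by (intro sum_mono) simp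
  also have "\<dots> = (1 - t) * (\<Sum>i\<in>UNIV. f i x) + t * (\<Sum>i\<in>UNIV. f i y)"
    by (simp add: sum.distrib sum_distrib_left)
  finally show "favg f ((1 - t) *\<^sub>R x + t *\<^sub>R y) \<le> (1 - t) * favg f x + t * favg f y"
    by (simp add: favg_def field_simps)
qed simp

subsection \<open>Energy and consensus\<close>

text \<open>Each entry is minus the sum of the \<open>n - 1\<close> others, to which Cauchy-Schwarz
  applies. This gains a factor \<open>1 - 1/n\<close> over the trivial bound.\<close>

lemma norm_component_le_of_sum_zero:
  fixes Y :: "'a::real_inner^'n"
  assumes "(\<Sum>i\<in>UNIV. Y $ i) = 0"
  shows "real CARD('n) * (norm (Y $ i))\<^sup>2 \<le> (real CARD('n) - 1) * (norm Y)\<^sup>2"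
proof -
  have "Y $ i = - (\<Sum>j\<in>UNIV-{i}. Y $ j)"
    using assms by (simp add: sum.remove[of UNIV i] eq_neg_iff_add_eq_0)
  hence "norm (Y $ i) \<le> (\<Sum>j\<in>UNIV-{i}. norm (Y $ j))"
    by (metis norm_minus_cancel norm_sum)
  hence "(norm (Y $ i))\<^sup>2 \<le> (\<Sum>j\<in>UNIV-{i}. norm (Y $ j))\<^sup>2"
    by (rule power_mono) simp
  also have "\<dots> \<le> (\<Sum>j\<in>UNIV-{i}. (norm (Y $ j))\<^sup>2) * real (card (UNIV-{i}))"
    by (rule sum_squared_le_sum_of_squares)
  also have "real (card (UNIV-{i})) = real CARD('n) - 1"
    by (simp add: card_Diff_singleton of_nat_diff Suc_leI)
  also have "(\<Sum>j\<in>UNIV-{i}. (norm (Y $ j))\<^sup>2) = (norm Y)\<^sup>2 - (norm (Y $ i))\<^sup>2"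
    by (simp add: power2_norm_vec sum.remove[of UNIV i])
  finally show ?thesis by (simp add: algebra_simps)
qed

text \<open>By Cauchy-Schwarz it suffices to add up the squares; their cross terms cancel because
  the entries sum to zero.\<close>

lemma sum_norm_diff_le_of_sum_zero:
  fixes Y :: "'a::real_inner^'n"
  assumes "(\<Sum>i\<in>UNIV. Y $ i) = 0"
  shows "(\<Sum>j\<in>UNIV. norm (Y $ i - Y $ j)) \<le> real CARD('n) * norm Y"
proof -
  let ?n = "real CARD('n)"
  have "(\<Sum>j\<in>UNIV. norm (Y $ i - Y $ j))\<^sup>2 \<le> (\<Sum>j\<in>UNIV. (norm (Y $ i - Y $ j))\<^sup>2) * ?n"
    by (rule sum_squared_le_sum_of_squares)
  also have "(\<Sum>j\<in>UNIV. (norm (Y $ i - Y $ j))\<^sup>2)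
      = (\<Sum>j\<in>UNIV. (norm (Y $ i))\<^sup>2 + (norm (Y $ j))\<^sup>2 - 2 * (Y $ i \<bullet> Y $ j))"
    by (simp add: power2_norm_eq_inner inner_diff_left inner_diff_right inner_commute)
  also have "\<dots> = ?n * (norm (Y $ i))\<^sup>2 + (norm Y)\<^sup>2 - 2 * (Y $ i \<bullet> (\<Sum>j\<in>UNIV. Y $ j))"
    by (simp add: sum_subtractf sum.distrib power2_norm_vec inner_sum_right sum_distrib_left)
  also have "\<dots> \<le> ?n * (norm Y)\<^sup>2"
    using norm_component_le_of_sum_zero[OF assms, of i] by (simp add: assms algebra_simps)
  finally have "(\<Sum>j\<in>UNIV. norm (Y $ i - Y $ j))\<^sup>2 \<le> (?n * norm Y)\<^sup>2"
    by (simp add: power2_eq_square mult_ac mult_right_mono)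
  thus ?thesis by (rule power2_le_imp_le) simp
qed

lemma sum_norm_le_sqrt_norm:
  fixes Y :: "'a::real_inner^'n"
  shows "(\<Sum>j\<in>UNIV. norm (Y $ j)) \<le> sqrt (real CARD('n)) * norm Y"
proof -
  have "(\<Sum>j\<in>UNIV. norm (Y $ j))\<^sup>2 \<le> (sqrt (real CARD('n)) * norm Y)\<^sup>2"
    using sum_squared_le_sum_of_squares[of "\<lambda>j. norm (Y $ j)" UNIV]
    by (simp add: power_mult_distrib power2_norm_vec mult.commute)
  thus ?thesis by (rule power2_le_imp_le) simp
qed

lemma norm_vmean_le: "norm (vmean Y) \<le> norm Y"
  for Y :: "'a::euclidean_space^'n"
proof -
  have "norm (vmean Y) \<le> (1 / real CARD('n)) * (\<Sum>j\<in>UNIV. norm (Y $ j))"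
    unfolding vmean_def by (simp add: divide_right_mono norm_sum)
  also have "\<dots> \<le> (1 / real CARD('n)) * (\<Sum>j\<in>(UNIV::'n set). norm Y)"
    by (intro mult_left_mono sum_mono Finite_Cartesian_Product.norm_nth_le) auto
  finally show ?thesis by simp
qed

section \<open>A single run of the iteration: constants, energy descent and consensus error\<close>

locale dgd_run =
  fixes f :: "'n::finite \<Rightarrow> 'a::euclidean_space \<Rightarrow> real"
    and L :: "'n \<Rightarrow> real" and E :: "('n \<times> 'n) set"
    and W :: "real^'n^'n" and lam :: "nat \<Rightarrow> real" and \<alpha> :: real
  assumes agents: "2 \<le> CARD('n)"
    and objectives: "\<And>i. admissible_objective (L i) (f i)"
    and mixing: "mixing_matrix E W lam"
    and step: "admissible_step L lam \<alpha>"
begin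

abbreviation "Lh \<equiv> Lmax L"
abbreviation "D \<equiv> Dconst L f"

definition X :: "nat \<Rightarrow> 'a^'n" where "X k = (\<chi> i. dgd W \<alpha> f k i)"
definition G :: "nat \<Rightarrow> 'a^'n" where "G k = (\<chi> i. grad (f i) (X k $ i))"

lemma GDERIV_objective: "GDERIV (f i) x :> grad (f i) x"
  using objectives[of i] by (intro differentiable_imp_GDERIV_grad) (simp add: admissible_objective_def)

lemma L_pos: "0 < L i" and convex: "convex_on UNIV (f i)" and bdd: "bdd_below (range (f i))"
  and lipschitz: "(L i)-lipschitz_on UNIV (grad (f i))"
  using objectives[of i] by (simp_all add: admissible_objective_def)

lemma L_le: "L i \<le> Lh"
  by (simp add: Lmax_def)

lemma Lh_pos: "0 < Lh"
  using L_pos L_le less_le_trans by blast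

lemma lipschitz_Lh: "Lh-lipschitz_on UNIV (grad (f i))"
  using lipschitz L_le by (rule lipschitz_on_le)

lemma Lavg_pos: "0 < Lavg L"
  unfolding Lavg_def by (intro divide_pos_pos sum_pos) (auto simp: L_pos)

lemma card_ge_2: "2 \<le> real CARD('n)" using agents by simp

lemma \<alpha>_pos: "0 < \<alpha>" and \<alpha>_Lh: "\<alpha> * Lh \<le> 1 + lam CARD('n)" and \<alpha>_Lavg: "\<alpha> * Lavg L \<le> 1"
  using step Lh_pos Lavg_pos by (auto simp: admissible_step_def field_simps)

lemma transpose_W: "transpose W = W" and ds: "doubly_stochastic W" and beta_less: "beta CARD('n) lam < 1"
  using mixing by (auto simp: mixing_matrix_def)

lemma beta_nonneg: "0 \<le> beta CARD('n) lam"
  by (auto simp: beta_def)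

lemma X_0: "X 0 = 0"
  by (simp add: X_def vec_eq_iff)

lemma X_Suc: "X (Suc k) = mix W (X k) - \<alpha> *\<^sub>R G k"
  by (simp add: X_def G_def mix_def vec_eq_iff)

lemma dgd_mean_eq: "dgd_mean W \<alpha> f k = vmean (X k)"
  by (simp add: dgd_mean_def vmean_def X_def)

lemma Inf_le: "(INF x. f i x) \<le> f i x"
  using bdd by (intro cINF_lower) auto

lemma fopt_sum_le: "fopt_sum f \<le> (\<Sum>i\<in>UNIV. f i (x i))"
  unfolding fopt_sum_def by (intro sum_mono Inf_le)

lemma D_sq: "D\<^sup>2 = 2 * Lh * ((\<Sum>i\<in>UNIV. f i 0) - fopt_sum f)"
  using fopt_sum_le[of "\<lambda>_. 0"] Lh_pos by (simp add: Dconst_def)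

lemma D_nonneg: "0 \<le> D"
  using fopt_sum_le[of "\<lambda>_. 0"] Lh_pos by (simp add: Dconst_def)

definition energy :: "'a^'n \<Rightarrow> real" where
  "energy Y = (Y \<bullet> Y - Y \<bullet> mix W Y) / 2 + \<alpha> * (\<Sum>i\<in>UNIV. f i (Y $ i))"

text \<open>To first order the energy changes by \<open>- (d \<bullet> d)\<close>. The second-order
  terms are at most half of \<open>(1 - lam n) + \<alpha> Lh\<close> times
  \<open>d \<bullet> d\<close>, and the step condition bounds this factor by 2, which is just
  enough.\<close>

lemma energy_descent: "energy (X (Suc k)) \<le> energy (X k)"
proof -
  define d where "d = X (Suc k) - X k"
  have X': "X (Suc k) = X k + d" by (simp add: d_def)
  have "X k - mix W (X k) + \<alpha> *\<^sub>R G k = - d" by (simp add: d_def X_Suc)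
  hence "d \<bullet> (X k - mix W (X k) + \<alpha> *\<^sub>R G k) = - (d \<bullet> d)" by simp
  \<comment> \<open>The left side is the derivative of the energy at \<open>X k\<close> in direction
    \<open>d\<close>.\<close>
  hence grad: "d \<bullet> X k - d \<bullet> mix W (X k) + \<alpha> * (G k \<bullet> d) = - (d \<bullet> d)"
    by (simp add: inner_add_right inner_diff_right inner_commute)
  have "(\<Sum>i\<in>UNIV. f i (X (Suc k) $ i))
      \<le> (\<Sum>i\<in>UNIV. f i (X k $ i) + G k $ i \<bullet> d $ i + Lh / 2 * (norm (d $ i))\<^sup>2)"
  proof (rule sum_mono)
    fix i
    show "f i (X (Suc k) $ i) \<le> f i (X k $ i) + G k $ i \<bullet> d $ i + Lh / 2 * (norm (d $ i))\<^sup>2"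
      using lipschitz_gradient_upper_bound[OF GDERIV_objective lipschitz_Lh, of i "X (Suc k) $ i" "X k $ i"]
      by (simp add: G_def d_def)
  qed
  also have "\<dots> = (\<Sum>i\<in>UNIV. f i (X k $ i)) + G k \<bullet> d + Lh / 2 * (d \<bullet> d)"
    by (simp add: sum.distrib inner_vec_def power2_norm_eq_inner sum_distrib_left)
  finally have "\<alpha> * (\<Sum>i\<in>UNIV. f i (X (Suc k) $ i))
      \<le> \<alpha> * ((\<Sum>i\<in>UNIV. f i (X k $ i)) + G k \<bullet> d + Lh / 2 * (d \<bullet> d))"
    using \<alpha>_pos by (intro mult_left_mono) auto
  hence "\<alpha> * (\<Sum>i\<in>UNIV. f i (X (Suc k) $ i))
      \<le> \<alpha> * (\<Sum>i\<in>UNIV. f i (X k $ i)) + \<alpha> * (G k \<bullet> d) + \<alpha> * Lh * (d \<bullet> d) / 2"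
    by (simp add: distrib_left)
  moreover have "X (Suc k) \<bullet> X (Suc k) - X (Suc k) \<bullet> mix W (X (Suc k))
     = (X k \<bullet> X k - X k \<bullet> mix W (X k)) + 2 * (d \<bullet> X k - d \<bullet> mix W (X k)) + d \<bullet> d - d \<bullet> mix W d"
    unfolding X' using mix_selfadjoint[OF transpose_W, of "X k" d]
    by (simp add: linear_add[OF linear_mix] inner_add_left inner_add_right inner_commute)
  moreover have "lam CARD('n) * (d \<bullet> d) \<le> d \<bullet> mix W d"
    using mixing_matrix_least_eigenvalue[OF mixing, of d] by (simp add: power2_norm_eq_inner)
  moreover have "\<alpha> * Lh * (d \<bullet> d) \<le> d \<bullet> d + lam CARD('n) * (d \<bullet> d)"
    using mult_right_mono[OF \<alpha>_Lh, of "d \<bullet> d"] by (simp add: distrib_right)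
  ultimately show ?thesis using grad unfolding energy_def by argo
qed

lemma energy_le: "energy (X k) \<le> \<alpha> * (\<Sum>i\<in>UNIV. f i 0)"
proof (induction k)
  case 0
  show ?case by (simp add: energy_def X_0)
next
  case (Suc k)
  with energy_descent[of k] show ?case by simp
qed

text \<open>The quadratic part of the energy dominates the deviation, and
  \<open>grad_norm_bound\<close> dominates the gradients by the objective gap. In the sum the
  current objective values cancel, leaving the initial energy minus the optimum.\<close>

lemma consensus_gradient_budget:
  "Lh * (1 - beta CARD('n) lam) * (norm (dev (X k)))\<^sup>2 + \<alpha> * (norm (G k))\<^sup>2 \<le> \<alpha> * D\<^sup>2"
proof -
  let ?Y = "dev (X k)" and ?c = "(\<chi> i. vmean (X k)) :: 'a^'n"
  have X: "X k = ?Y + ?c" by (simp add: dev_def)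
  have c: "mix W ?c = ?c" by (rule doubly_stochastic_mix_const[OF ds])
  \<comment> \<open>The consensus part is fixed by \<open>mix W\<close>, so it drops out of the form
    together with the cross terms.\<close>
  have "X k \<bullet> X k - X k \<bullet> mix W (X k) = ?Y \<bullet> ?Y - ?Y \<bullet> mix W ?Y"
    using mix_selfadjoint[OF transpose_W, of ?c ?Y]
    by (subst (1 2 3 4) X) (simp add: linear_add[OF linear_mix] c inner_add_left inner_add_right inner_commute)
  also have "\<dots> \<ge> (1 - beta CARD('n) lam) * (norm ?Y)\<^sup>2"
  proof -
    have "?Y \<bullet> mix W ?Y \<le> norm ?Y * norm (mix W ?Y)" by (rule norm_cauchy_schwarz)
    also have "\<dots> \<le> norm ?Y * (beta CARD('n) lam * norm ?Y)"
      by (intro mult_left_mono mixing_matrix_contraction[OF agents mixing]) auto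
    finally show ?thesis by (simp add: dot_square_norm power2_eq_square algebra_simps)
  qed
  finally have quad: "(1 - beta CARD('n) lam) * (norm ?Y)\<^sup>2 \<le> X k \<bullet> X k - X k \<bullet> mix W (X k)" .
  have "(norm (G k))\<^sup>2 \<le> (\<Sum>i\<in>UNIV. 2 * Lh * (f i (X k $ i) - (INF x. f i x)))"
    unfolding power2_norm_vec
    using grad_norm_bound[OF GDERIV_objective lipschitz_Lh Lh_pos bdd] by (intro sum_mono) (simp add: G_def)
  also have "\<dots> = 2 * Lh * ((\<Sum>i\<in>UNIV. f i (X k $ i)) - fopt_sum f)"
    by (simp add: fopt_sum_def sum_distrib_left[symmetric] sum_subtractf)
  finally have "\<alpha> * (norm (G k))\<^sup>2 \<le> 2 * Lh * (\<alpha> * (\<Sum>i\<in>UNIV. f i (X k $ i)) - \<alpha> * fopt_sum f)"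
    using mult_left_mono[of _ _ \<alpha>] \<alpha>_pos by (fastforce simp: algebra_simps)
  moreover have "Lh * ((1 - beta CARD('n) lam) * (norm ?Y)\<^sup>2) \<le>
     Lh * (2 * (\<alpha> * (\<Sum>i\<in>UNIV. f i 0) - \<alpha> * (\<Sum>i\<in>UNIV. f i (X k $ i))))"
    using Lh_pos quad energy_le[of k] by (intro mult_left_mono) (simp_all add: energy_def field_simps)
  ultimately show ?thesis unfolding D_sq by (simp add: algebra_simps)
qed

lemma norm_G_le: "norm (G k) \<le> D"
proof -
  have "0 \<le> Lh * (1 - beta CARD('n) lam) * (norm (dev (X k)))\<^sup>2"
    using Lh_pos beta_less by simp
  hence "\<alpha> * (norm (G k))\<^sup>2 \<le> \<alpha> * D\<^sup>2" using consensus_gradient_budget[of k] by linarith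
  hence "(norm (G k))\<^sup>2 \<le> D\<^sup>2" using \<alpha>_pos by simp
  thus ?thesis by (rule power2_le_imp_le) (rule D_nonneg)
qed

text \<open>The deviation obeys \<open>d' <= b d + \<alpha> D\<close> with \<open>b\<close> the
  contraction factor, starts at 0, and so stays below the fixed point
  \<open>\<alpha> D / (1 - b)\<close>.\<close>

lemma norm_dev_X_le: "(1 - beta CARD('n) lam) * norm (dev (X k)) \<le> \<alpha> * D"
proof (induction k)
  case 0
  show ?case using \<alpha>_pos D_nonneg by (simp add: X_0 linear_0[OF linear_dev])
next
  case (Suc k)
  let ?b = "beta CARD('n) lam"
  have "dev (X (Suc k)) = mix W (dev (X k)) - \<alpha> *\<^sub>R dev (G k)"
    by (simp add: X_Suc linear_diff[OF linear_dev] linear_cmul[OF linear_dev] dev_mix[OF ds])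
  hence "norm (dev (X (Suc k))) \<le> norm (mix W (dev (X k))) + \<alpha> * norm (dev (G k))"
    using norm_triangle_ineq4[of "mix W (dev (X k))" "\<alpha> *\<^sub>R dev (G k)"] \<alpha>_pos by simp
  also have "\<dots> \<le> ?b * norm (dev (X k)) + \<alpha> * D"
    using mixing_matrix_contraction[OF agents mixing, of "dev (X k)"]
      order_trans[OF norm_dev_le norm_G_le, of k] \<alpha>_pos by (intro add_mono mult_left_mono) auto
  finally have "(1 - ?b) * norm (dev (X (Suc k))) \<le> (1 - ?b) * (?b * norm (dev (X k)) + \<alpha> * D)"
    using beta_less by (intro mult_left_mono) auto
  also have "\<dots> = ?b * ((1 - ?b) * norm (dev (X k))) + (1 - ?b) * (\<alpha> * D)" by (simp add: algebra_simps)
  also have "\<dots> \<le> ?b * (\<alpha> * D) + (1 - ?b) * (\<alpha> * D)"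
    using Suc beta_nonneg by (intro add_right_mono mult_left_mono)
  finally show ?case by (simp add: algebra_simps)
qed

lemma norm_grad_diff_le: "norm (grad (f i) x - grad (f i) y) \<le> Lh * norm (x - y)"
  using lipschitz_onD[OF lipschitz_Lh, of x y] by (simp add: dist_norm)

lemma average_gradient_times_deviation:
  "(1 / real CARD('n)) * (\<Sum>j\<in>UNIV. norm (grad (f j) (X k $ i)) * norm (X k $ i - vmean (X k)))
     \<le> \<alpha> * D\<^sup>2 / (1 - beta CARD('n) lam)"
proof -
  let ?Y = "dev (X k)"
  define \<delta> where "\<delta> = norm ?Y"
  define g where "g = norm (G k)"
  \<comment> \<open>A rational upper bound for \<open>sqrt (1 - 1/n)\<close>: its square is
    \<open>1 - 1/n + 1/(4 n^2)\<close>.\<close>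
  define c where "c = 1 - 1 / (2 * real CARD('n))"
  define S where "S = (1 / real CARD('n)) * (\<Sum>j\<in>UNIV. norm (grad (f j) (X k $ i)))"
  define \<kappa> where "\<kappa> = 1 - beta CARD('n) lam"
  have pos: "0 \<le> \<delta>" "0 \<le> g" "0 \<le> c" "0 \<le> S" "0 < \<kappa>"
    using card_ge_2 beta_less by (auto simp: \<delta>_def g_def c_def S_def \<kappa>_def field_simps sum_nonneg)
  have "real CARD('n) * (norm (?Y $ i))\<^sup>2 \<le> (real CARD('n) - 1) * \<delta>\<^sup>2"
    unfolding \<delta>_def by (rule norm_component_le_of_sum_zero) simp
  also have "\<dots> \<le> real CARD('n) * (c * \<delta>)\<^sup>2"
    using card_ge_2 pos(1) by (simp add: c_def power_mult_distrib power2_eq_square field_simps)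
  finally have "(norm (?Y $ i))\<^sup>2 \<le> (c * \<delta>)\<^sup>2" using card_ge_2 by simp
  hence \<delta>i: "norm (?Y $ i) \<le> c * \<delta>" by (rule power2_le_imp_le) (simp add: pos)
  \<comment> \<open>Each gradient at the iterate of agent \<open>i\<close> is compared with the one
    at the iterate of its owner \<open>j\<close>; the difference of iterates equals the difference
    of deviations.\<close>
  have "real CARD('n) * S \<le> (\<Sum>j\<in>UNIV. norm (G k $ j) + Lh * norm (?Y $ i - ?Y $ j))"
    unfolding S_def using card_ge_2
  proof (simp, intro sum_mono)
    fix j
    have "norm (grad (f j) (X k $ i)) \<le> norm (grad (f j) (X k $ j))
        + norm (grad (f j) (X k $ i) - grad (f j) (X k $ j))"
      by (rule norm_triangle_sub)
    thus "norm (grad (f j) (X k $ i)) \<le> norm (G k $ j) + Lh * norm (?Y $ i - ?Y $ j)"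
      using norm_grad_diff_le[of j "X k $ i" "X k $ j"] by (simp add: G_def dev_def)
  qed
  also have "\<dots> = (\<Sum>j\<in>UNIV. norm (G k $ j)) + Lh * (\<Sum>j\<in>UNIV. norm (?Y $ i - ?Y $ j))"
    by (simp add: sum.distrib sum_distrib_left)
  also have "\<dots> \<le> sqrt (real CARD('n)) * g + Lh * (real CARD('n) * \<delta>)"
    unfolding g_def \<delta>_def using Lh_pos
    by (intro add_mono mult_left_mono sum_norm_le_sqrt_norm sum_norm_diff_le_of_sum_zero) auto
  finally have "S \<le> (sqrt (real CARD('n)) * g + Lh * (real CARD('n) * \<delta>)) / real CARD('n)"
    by (simp add: field_simps)
  also have "\<dots> = g / sqrt (real CARD('n)) + Lh * \<delta>"
    using real_div_sqrt[of "real CARD('n)"] by (simp add: field_simps)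
  finally have S: "S \<le> g / sqrt (real CARD('n)) + Lh * \<delta>" .
  have "\<kappa> * (S * norm (?Y $ i)) \<le> \<kappa> * (S * (c * \<delta>))"
    using pos \<delta>i by (intro mult_left_mono) auto
  also have "\<dots> = c * (\<kappa> * \<delta>) * S" by simp
  also have "\<dots> \<le> c * (\<kappa> * \<delta>) * (g / sqrt (real CARD('n)) + Lh * \<delta>)"
    using pos S by (intro mult_left_mono) auto
  also have "\<dots> = c * ((\<kappa> * \<delta>) * (g / sqrt (real CARD('n))) + Lh * \<kappa> * \<delta>\<^sup>2)"
    by (simp add: algebra_simps power2_eq_square)
  \<comment> \<open>The two products are treated differently: the first uses the bound on the
    deviation, the second the energy budget, whose term \<open>- \<alpha> * g\<^sup>2\<close> is
    kept to offset the first.\<close>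
  also have "\<dots> \<le> c * ((\<alpha> * D) * (g / sqrt (real CARD('n))) + (\<alpha> * D\<^sup>2 - \<alpha> * g\<^sup>2))"
    using pos norm_dev_X_le[of k] consensus_gradient_budget[of k]
    by (intro mult_left_mono add_mono mult_right_mono) (auto simp: \<kappa>_def \<delta>_def g_def)
  also have "\<dots> = \<alpha> * (c * (D * (g / sqrt (real CARD('n))) - g\<^sup>2 + D\<^sup>2))" by (simp add: algebra_simps)
  also have "\<dots> \<le> \<alpha> * (c * (D\<^sup>2 / (4 * real CARD('n)) + D\<^sup>2))"
  proof -
    \<comment> \<open>Completing the square in \<open>g\<close> leaves an excess of only
      \<open>D^2 / (4 n)\<close>.\<close>
    have "0 \<le> (g - D / (2 * sqrt (real CARD('n))))\<^sup>2" by simp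
    also have "\<dots> = g\<^sup>2 - D * (g / sqrt (real CARD('n))) + D\<^sup>2 / (4 * real CARD('n))"
      using card_ge_2 by (simp add: power2_diff power_divide power_mult_distrib)
    finally show ?thesis using pos \<alpha>_pos by (intro mult_left_mono) auto
  qed
  also have "\<dots> = \<alpha> * (c * (1 + 1 / (4 * real CARD('n))) * D\<^sup>2)" by (simp add: algebra_simps)
  also have "\<dots> \<le> \<alpha> * (1 * D\<^sup>2)"
  proof -
    \<comment> \<open>The product is \<open>1 - 1/(4 n) - 1/(8 n^2)\<close>, so the gain in
      \<open>c\<close> outweighs the excess.\<close>
    have "c * (1 + 1 / (4 * real CARD('n))) \<le> 1"
      using card_ge_2 by (simp add: c_def field_simps)
    thus ?thesis using \<alpha>_pos by (intro mult_left_mono mult_right_mono) auto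
  qed
  finally have "\<kappa> * (S * norm (?Y $ i)) \<le> \<alpha> * D\<^sup>2" by simp
  hence "S * norm (?Y $ i) \<le> \<alpha> * D\<^sup>2 / \<kappa>" using pos by (simp add: field_simps)
  moreover have "?Y $ i = X k $ i - vmean (X k)" by (simp add: dev_def)
  ultimately show ?thesis by (simp add: S_def \<kappa>_def sum_distrib_right mult.assoc)
qed

subsection \<open>Convergence rate\<close>

abbreviation g :: "nat \<Rightarrow> 'a" where "g k \<equiv> vmean (G k)"
abbreviation xbar :: "nat \<Rightarrow> 'a" where "xbar k \<equiv> vmean (X k)"

lemma xbar_Suc: "xbar (Suc k) = xbar k - \<alpha> *\<^sub>R g k"
proof -
  have "vmean (mix W (X k)) = xbar k"
    by (simp add: vmean_def doubly_stochastic_sum_mix[OF ds])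
  thus ?thesis by (simp add: X_Suc linear_diff[OF linear_vmean] linear_cmul[OF linear_vmean])
qed

lemma favg_GDERIV_grad: "GDERIV (favg f) x :> grad (favg f) x"
  and grad_favg: "grad (favg f) x = vmean (\<chi> j. grad (f j) x)"
proof -
  have *: "GDERIV (favg f) x :> (1 / real CARD('n)) *\<^sub>R (\<Sum>i\<in>UNIV. grad (f i) x)"
    by (rule favg_GDERIV) (rule GDERIV_objective)
  from grad_eqI[OF this] show "grad (favg f) x = vmean (\<chi> j. grad (f j) x)"
    by (simp add: vmean_def)
  from grad_eqI[OF *] * show "GDERIV (favg f) x :> grad (favg f) x" by simp
qed

lemma favg_above_tangent: "favg f x + grad (favg f) x \<bullet> (y - x) \<le> favg f y"
  by (rule convex_first_order_lower_bound[OF favg_convex[OF convex] favg_GDERIV_grad])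

lemma favg_smooth:
  "favg f y \<le> favg f x + grad (favg f) x \<bullet> (y - x) + Lavg L / 2 * (norm (y - x))\<^sup>2"
proof -
  have "(\<Sum>i\<in>UNIV. f i y) \<le> (\<Sum>i\<in>UNIV. f i x + grad (f i) x \<bullet> (y - x) + L i / 2 * (norm (y - x))\<^sup>2)"
    by (intro sum_mono lipschitz_gradient_upper_bound[OF GDERIV_objective lipschitz])
  also have "\<dots> = (\<Sum>i\<in>UNIV. f i x) + (\<Sum>i\<in>UNIV. grad (f i) x) \<bullet> (y - x) + (\<Sum>i\<in>UNIV. L i) / 2 * (norm (y - x))\<^sup>2"
    by (simp add: sum.distrib inner_sum_left sum_distrib_right sum_divide_distrib)
  finally have "favg f y \<le> \<dots> / real CARD('n)"
    unfolding favg_def by (rule divide_right_mono) simp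
  thus ?thesis by (simp add: favg_def grad_favg vmean_def Lavg_def add_divide_distrib)
qed

lemma norm_grad_favg_diff_le: "norm (g k - grad (favg f) (xbar k)) \<le> Lh * norm (dev (X k))"
proof -
  let ?H = "(\<chi> j. grad (f j) (xbar k)) :: 'a^'n"
  have "g k - grad (favg f) (xbar k) = vmean (G k - ?H)"
    by (simp add: grad_favg linear_diff[OF linear_vmean])
  also have "norm \<dots> \<le> norm (G k - ?H)" by (rule norm_vmean_le)
  also have "\<dots> \<le> norm (Lh *\<^sub>R dev (X k))"
    using norm_grad_diff_le Lh_pos
    by (intro norm_le_componentwise_cart) (simp add: G_def dev_def)
  finally show ?thesis using Lh_pos by simp
qed

lemma norm_g_le: "norm (g k) \<le> D"
  using norm_vmean_le norm_G_le order_trans by blast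

text \<open>With \<open>\<alpha> * Lavg L \<le> 1\<close> an inexact gradient step changes the
  objective by at most \<open>\<alpha> / 2\<close> times the squared gradient error minus the
  squared true gradient norm.\<close>

lemma descent_of_large_gradient:
  assumes "norm (g k - grad (favg f) (xbar k)) \<le> norm (grad (favg f) (xbar k))"
  shows "favg f (xbar (Suc k)) \<le> favg f (xbar k)"
proof -
  let ?h = "grad (favg f) (xbar k)"
  have "favg f (xbar (Suc k)) \<le> favg f (xbar k) - \<alpha> * (?h \<bullet> g k) + (\<alpha> * Lavg L) * (\<alpha> / 2 * (norm (g k))\<^sup>2)"
    using favg_smooth[of "xbar (Suc k)" "xbar k"] \<alpha>_pos
    by (simp add: xbar_Suc power_mult_distrib power2_eq_square mult_ac)
  also have "\<dots> \<le> favg f (xbar k) - \<alpha> * (?h \<bullet> g k) + 1 * (\<alpha> / 2 * (norm (g k))\<^sup>2)"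
    using \<alpha>_pos \<alpha>_Lavg by (intro add_left_mono mult_right_mono) auto
  also have "\<dots> = favg f (xbar k) + \<alpha> / 2 * ((norm (g k - ?h))\<^sup>2 - (norm ?h)\<^sup>2)"
    by (simp add: power2_norm_eq_inner inner_diff_left inner_diff_right inner_commute algebra_simps)
  also have "\<dots> \<le> favg f (xbar k)"
  proof -
    have "(norm (g k - ?h))\<^sup>2 - (norm ?h)\<^sup>2 \<le> 0" using assms by (simp add: power_mono)
    thus ?thesis using \<alpha>_pos by (simp add: mult_nonneg_nonpos)
  qed
  finally show ?thesis .
qed

text \<open>The recursion of the averages is a gradient step with an inexact first-order oracle for
  the average objective, whose inexactness is the consensus error.\<close>

lemma rate_step:
  "favg f (xbar (Suc k)) - favg f y \<le>
     ((norm (xbar k - y))\<^sup>2 - (norm (xbar (Suc k) - y))\<^sup>2) / (2 * \<alpha>)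
       + 2 * D\<^sup>2 * (\<alpha> / (1 - beta CARD('n) lam))"
proof -
  let ?z = "xbar (Suc k)" and ?Y = "dev (X k)" and ?n = "real CARD('n)" and ?b = "beta CARD('n) lam"
  have Y: "?Y $ i = X k $ i - xbar k" for i by (simp add: dev_def)
  \<comment> \<open>Convexity and smoothness of \<open>f i\<close> are both used at the agent's own
    iterate, where \<open>G k\<close> is the exact gradient. The distance from there to
    \<open>?z\<close> splits into the step and the deviation by
    \<open>(a + b)^2 <= 2 a^2 + 2 b^2\<close>.\<close>
  have each: "f i ?z - f i y \<le> G k $ i \<bullet> (?z - y) + \<alpha>\<^sup>2 * (norm (g k))\<^sup>2 * L i + Lh * (norm (?Y $ i))\<^sup>2" for i
  proof -
    have "f i (X k $ i) + G k $ i \<bullet> (y - X k $ i) \<le> f i y"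
      using convex_first_order_lower_bound[OF convex GDERIV_objective] by (simp add: G_def)
    moreover have "f i ?z \<le> f i (X k $ i) + G k $ i \<bullet> (?z - X k $ i) + L i / 2 * (norm (?z - X k $ i))\<^sup>2"
      using lipschitz_gradient_upper_bound[OF GDERIV_objective lipschitz] by (simp add: G_def)
    moreover have "L i / 2 * (norm (?z - X k $ i))\<^sup>2
        \<le> L i / 2 * (2 * (\<alpha>\<^sup>2 * (norm (g k))\<^sup>2) + 2 * (norm (?Y $ i))\<^sup>2)"
    proof (rule mult_left_mono)
      have "?z - X k $ i = - (\<alpha> *\<^sub>R g k + ?Y $ i)" by (simp add: xbar_Suc Y)
      hence "norm (?z - X k $ i) \<le> \<alpha> * norm (g k) + norm (?Y $ i)"
        using norm_triangle_ineq[of "\<alpha> *\<^sub>R g k" "?Y $ i"] \<alpha>_pos by (simp only: norm_minus_cancel) simp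
      hence "(norm (?z - X k $ i))\<^sup>2 \<le> (\<alpha> * norm (g k) + norm (?Y $ i))\<^sup>2" by (rule power_mono) simp
      also have "\<dots> \<le> 2 * (\<alpha> * norm (g k))\<^sup>2 + 2 * (norm (?Y $ i))\<^sup>2"
        using zero_le_power2[of "\<alpha> * norm (g k) - norm (?Y $ i)"] by (simp add: power2_diff power2_sum)
      finally show "(norm (?z - X k $ i))\<^sup>2 \<le> 2 * (\<alpha>\<^sup>2 * (norm (g k))\<^sup>2) + 2 * (norm (?Y $ i))\<^sup>2"
        by (simp add: power_mult_distrib)
    qed (use L_pos[of i] in simp)
    moreover have "L i * (norm (?Y $ i))\<^sup>2 \<le> Lh * (norm (?Y $ i))\<^sup>2"
      by (intro mult_right_mono L_le) simp
    moreover have "G k $ i \<bullet> (?z - X k $ i) - G k $ i \<bullet> (y - X k $ i) = G k $ i \<bullet> (?z - y)"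
      by (simp add: inner_diff_right)
    ultimately show ?thesis by (simp add: algebra_simps)
  qed
  have "(\<Sum>i\<in>UNIV. f i ?z) - (\<Sum>i\<in>UNIV. f i y)
      \<le> (\<Sum>i\<in>UNIV. G k $ i \<bullet> (?z - y) + \<alpha>\<^sup>2 * (norm (g k))\<^sup>2 * L i + Lh * (norm (?Y $ i))\<^sup>2)"
    unfolding sum_subtractf[symmetric] by (intro sum_mono each)
  also have "\<dots> = (\<Sum>i\<in>UNIV. G k $ i) \<bullet> (?z - y) + \<alpha>\<^sup>2 * (norm (g k))\<^sup>2 * (\<Sum>i\<in>UNIV. L i) + Lh * (norm ?Y)\<^sup>2"
    by (simp add: sum.distrib inner_sum_left sum_distrib_left power2_norm_vec)
  finally have "((\<Sum>i\<in>UNIV. f i ?z) - (\<Sum>i\<in>UNIV. f i y)) / ?n \<le> \<dots> / ?n"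
    by (rule divide_right_mono) simp
  hence "favg f ?z - favg f y \<le> g k \<bullet> (?z - y) + \<alpha> * (norm (g k))\<^sup>2 * (\<alpha> * Lavg L) + Lh * (norm ?Y)\<^sup>2 / ?n"
    by (simp add: favg_def vmean_def Lavg_def add_divide_distrib diff_divide_distrib power2_eq_square mult_ac)
  also have "\<dots> \<le> g k \<bullet> (?z - y) + \<alpha> * (norm (g k))\<^sup>2 * 1 + Lh * (norm ?Y)\<^sup>2"
  proof (intro add_mono mult_left_mono order_refl \<alpha>_Lavg)
    have "Lh * (norm ?Y)\<^sup>2 * 1 \<le> Lh * (norm ?Y)\<^sup>2 * ?n"
      using card_ge_2 Lh_pos by (intro mult_left_mono) auto
    thus "Lh * (norm ?Y)\<^sup>2 / ?n \<le> Lh * (norm ?Y)\<^sup>2" by (simp add: field_simps)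
  qed (use \<alpha>_pos in simp)
  \<comment> \<open>The three-point identity for \<open>?z = xbar k - \<alpha> g k\<close> produces
    the telescoping difference of squared distances.\<close>
  also have "g k \<bullet> (?z - y) + \<alpha> * (norm (g k))\<^sup>2 * 1 =
     ((norm (xbar k - y))\<^sup>2 - (norm (?z - y))\<^sup>2) / (2 * \<alpha>) + \<alpha> * (norm (g k))\<^sup>2 / 2"
  proof -
    define u where "u = xbar k - y"
    have z: "?z - y = u - \<alpha> *\<^sub>R g k" by (simp add: u_def xbar_Suc)
    show ?thesis unfolding z u_def[symmetric] using \<alpha>_pos
      by (simp add: power2_norm_eq_inner inner_diff_left inner_diff_right inner_commute field_simps)
  qed
  also have "\<alpha> * (norm (g k))\<^sup>2 / 2 \<le> D\<^sup>2 * (\<alpha> / (1 - ?b))"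
  proof -
    have "\<alpha> * (norm (g k))\<^sup>2 / 2 \<le> \<alpha> * D\<^sup>2"
    proof -
      have "(norm (g k))\<^sup>2 / 2 \<le> D\<^sup>2"
        using power_mono[OF norm_g_le norm_ge_zero, of k 2] zero_le_power2[of D] by linarith
      thus ?thesis using mult_left_mono[of _ "D\<^sup>2" \<alpha>] \<alpha>_pos by fastforce
    qed
    also have "\<dots> * (1 - ?b) \<le> \<alpha> * D\<^sup>2 * 1"
      using beta_nonneg \<alpha>_pos by (intro mult_left_mono) auto
    hence "\<alpha> * D\<^sup>2 \<le> D\<^sup>2 * (\<alpha> / (1 - ?b))" using beta_less by (simp add: field_simps)
    finally show ?thesis .
  qed
  also have "Lh * (norm ?Y)\<^sup>2 \<le> D\<^sup>2 * (\<alpha> / (1 - ?b))"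
  proof -
    have "0 \<le> \<alpha> * (norm (G k))\<^sup>2" using \<alpha>_pos by simp
    hence "Lh * (norm ?Y)\<^sup>2 * (1 - ?b) \<le> \<alpha> * D\<^sup>2"
      using consensus_gradient_budget[of k] by (simp add: mult_ac)
    thus ?thesis using beta_less by (simp add: field_simps)
  qed
  finally show ?thesis by (simp add: algebra_simps)
qed

lemma rate_until_level:
  assumes opt: "\<And>y. favg f xs \<le> favg f y"
    and level: "\<And>s. s \<le> k \<Longrightarrow>
      (4 * D\<^sup>2 + Lh * D * norm xs + 1) * (\<alpha> / (1 - beta CARD('n) lam)) < favg f (xbar s) - favg f xs"
  shows "real k * (favg f (xbar k) - favg f xs) \<le> (norm xs)\<^sup>2 / \<alpha>"
proof -
  let ?e = "\<alpha> / (1 - beta CARD('n) lam)" and ?r = "\<lambda>s. favg f (xbar s) - favg f xs"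
  let ?R = "\<lambda>s. norm (xbar s - xs)"
  have e: "0 < ?e" using \<alpha>_pos beta_less by simp
  \<comment> \<open>The run starts at 0, so \<open>norm xs\<close> is the initial distance. Its
    bound is carried along because it turns a large objective error into a large gradient.\<close>
  have "?R k \<le> norm xs \<and> real k * ?r k \<le> ((norm xs)\<^sup>2 - (?R k)\<^sup>2) / \<alpha>"
    using level
  proof (induction k)
    case 0
    show ?case using \<alpha>_pos by (simp add: X_0 linear_0[OF linear_vmean])
  next
    case (Suc k)
    hence IH: "?R k \<le> norm xs" "real k * ?r k \<le> ((norm xs)\<^sup>2 - (?R k)\<^sup>2) / \<alpha>" by auto
    have nn: "0 \<le> Lh * D * norm xs * ?e" "0 \<le> D\<^sup>2 * ?e"
      using Lh_pos D_nonneg by (intro mult_nonneg_nonneg less_imp_le[OF e]; simp)+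
    \<comment> \<open>The level has two purposes: \<open>4 * D\<^sup>2\<close> absorbs the error of
      \<open>rate_step\<close>, and \<open>Lh * D * norm xs\<close> keeps the gradient above its
      inexactness. The summand 1 makes the second inequality strict.\<close>
    have lv: "4 * (D\<^sup>2 * ?e) \<le> ?r s" "Lh * D * norm xs * ?e < ?r s" if "s \<le> Suc k" for s
      using Suc.prems[OF that] nn e by (simp_all only: distrib_right mult.assoc)
    have "?r (Suc k) \<le> ((?R k)\<^sup>2 - (?R (Suc k))\<^sup>2) / (2 * \<alpha>) + 2 * (D\<^sup>2 * ?e)"
      using rate_step[of k xs] by (simp only: mult.assoc)
    \<comment> \<open>Half of the objective error pays for the inexactness, at the price of a factor
      2 in the rate.\<close>
    hence "?r (Suc k) / 2 \<le> ((?R k)\<^sup>2 - (?R (Suc k))\<^sup>2) / (2 * \<alpha>)" using lv(1)[OF order_refl] by argo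
    hence dec: "?r (Suc k) \<le> ((?R k)\<^sup>2 - (?R (Suc k))\<^sup>2) / \<alpha>"
      unfolding mult.commute[of 2 \<alpha>] divide_divide_eq_left[symmetric]
      by (simp only: divide_le_cancel)
    moreover have "0 \<le> ?r (Suc k)" using opt by simp
    ultimately have "0 \<le> ((?R k)\<^sup>2 - (?R (Suc k))\<^sup>2) / \<alpha>" by linarith
    hence "(?R (Suc k))\<^sup>2 \<le> (?R k)\<^sup>2" using \<alpha>_pos by (simp add: zero_le_divide_iff)
    hence R: "?R (Suc k) \<le> norm xs" using IH(1) power2_le_imp_le norm_ge_zero order_trans by blast
    let ?h = "grad (favg f) (xbar k)"
    have "?r k \<le> ?h \<bullet> (xbar k - xs)"
      using favg_above_tangent[of "xbar k" xs] by (simp add: inner_diff_right)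
    also have "\<dots> \<le> norm ?h * ?R k" by (rule norm_cauchy_schwarz)
    also have "\<dots> \<le> norm ?h * norm xs" using IH(1) by (intro mult_left_mono) auto
    finally have "Lh * D * ?e * norm xs < norm ?h * norm xs" using lv(2)[of k] by (simp add: mult_ac)
    hence "Lh * D * ?e < norm ?h" by (meson mult_right_mono norm_ge_zero not_le)
    moreover have "Lh * norm (dev (X k)) \<le> Lh * D * ?e"
    proof -
      have "norm (dev (X k)) \<le> D * ?e"
        using norm_dev_X_le[of k] beta_less by (simp add: field_simps)
      from mult_left_mono[OF this, of Lh] show ?thesis using Lh_pos by (simp add: mult.assoc)
    qed
    ultimately have "?r (Suc k) \<le> ?r k"
      using descent_of_large_gradient[of k] norm_grad_favg_diff_le[of k] by linarith
    \<comment> \<open>Monotonicity replaces the earlier error by the newest one, so that the two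
      bounds add up and telescope.\<close>
    hence "real k * ?r (Suc k) \<le> real k * ?r k" by (rule mult_left_mono) simp
    note add_mono[OF order_trans[OF this IH(2)] dec]
    also have "real k * ?r (Suc k) + ?r (Suc k) = real (Suc k) * ?r (Suc k)"
      by (simp add: distrib_right)
    also have "((norm xs)\<^sup>2 - (?R k)\<^sup>2) / \<alpha> + ((?R k)\<^sup>2 - (?R (Suc k))\<^sup>2) / \<alpha>
        = ((norm xs)\<^sup>2 - (?R (Suc k))\<^sup>2) / \<alpha>" by (simp flip: add_divide_distrib)
    finally show ?case using R by simp
  qed
  moreover have "((norm xs)\<^sup>2 - (?R k)\<^sup>2) / \<alpha> \<le> (norm xs)\<^sup>2 / \<alpha>"
    using \<alpha>_pos by (intro divide_right_mono) auto
  ultimately show ?thesis by linarith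
qed

section \<open>From the mean iterate to the individual agents\<close>

lemma error_chain:
  fixes k i xs
  defines "x \<equiv> dgd W \<alpha> f k i" and "xb \<equiv> dgd_mean W \<alpha> f k"
  shows "favg f x - favg f xs \<le> favg f xb - favg f xs + grad (favg f) x \<bullet> (x - xb)" (is ?A)
    and "grad (favg f) x \<bullet> (x - xb)
      \<le> (1 / real CARD('n)) * (\<Sum>j\<in>UNIV. norm (grad (f j) x) * norm (x - xb))" (is ?B)
    and "(1 / real CARD('n)) * (\<Sum>j\<in>UNIV. norm (grad (f j) x) * norm (x - xb))
      \<le> \<alpha> * D\<^sup>2 / (1 - beta CARD('n) lam)" (is ?C)
proof -
  show ?A using favg_above_tangent[of x xb] by (simp add: inner_diff_right)
  have "grad (favg f) x \<bullet> (x - xb) = (1 / real CARD('n)) * (\<Sum>j\<in>UNIV. grad (f j) x \<bullet> (x - xb))"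
    by (simp add: grad_favg vmean_def inner_sum_left)
  also have "\<dots> \<le> (1 / real CARD('n)) * (\<Sum>j\<in>UNIV. norm (grad (f j) x) * norm (x - xb))"
    by (intro mult_left_mono sum_mono norm_cauchy_schwarz) simp
  finally show ?B .
  have "X k $ i = x" by (simp add: X_def x_def)
  thus ?C using average_gradient_times_deviation[of k i] by (simp add: xb_def dgd_mean_eq)
qed

lemma local_error_le:
  "favg f (dgd W \<alpha> f k i) - favg f xs
     \<le> favg f (dgd_mean W \<alpha> f k) - favg f xs + D\<^sup>2 * (\<alpha> / (1 - beta CARD('n) lam))"
  using error_chain(1)[of k i xs] error_chain(2,3)[of k i] by (simp add: mult.commute)

text \<open>\<open>C2\<close> exceeds the level of \<open>rate_until_level\<close> by
  \<open>2 * D\<^sup>2\<close>. An agent above it has its mean iterate above that level, since the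
  two errors differ by at most \<open>D\<^sup>2 * ?e\<close>; this difference is also less than half
  of the agent's error, whence the factor 2 in \<open>C1\<close>.\<close>

lemma sublinear_until_level:
  fixes xs
  defines "C1 \<equiv> 2 * (norm xs)\<^sup>2 + 1" and "C2 \<equiv> 6 * D\<^sup>2 + Lh * D * norm xs + 1"
  assumes opt: "\<And>y. favg f xs \<le> favg f y"
  shows "sublinear_until (C1 / \<alpha>) (C2 * \<alpha> / (1 - beta CARD('n) lam))
           (\<lambda>k. favg f (dgd_mean W \<alpha> f k) - favg f xs)" (is ?A)
    and "sublinear_until (C1 / \<alpha>) (C2 * \<alpha> / (1 - beta CARD('n) lam))
           (\<lambda>k. favg f (dgd W \<alpha> f k i) - favg f xs)" (is ?B)
proof -
  let ?e = "\<alpha> / (1 - beta CARD('n) lam)" and ?r = "\<lambda>s. favg f (xbar s) - favg f xs"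
  have e: "0 < ?e" using \<alpha>_pos beta_less by simp
  have De: "0 \<le> D\<^sup>2 * ?e" "0 \<le> Lh * D * norm xs * ?e"
    using Lh_pos D_nonneg by (intro mult_nonneg_nonneg less_imp_le[OF e]; simp)+
  have C2: "C2 * \<alpha> / (1 - beta CARD('n) lam)
      = (4 * D\<^sup>2 + Lh * D * norm xs + 1) * ?e + 2 * (D\<^sup>2 * ?e)"
    unfolding C2_def by (simp add: algebra_simps add_divide_distrib)
  have low: "2 * (D\<^sup>2 * ?e) \<le> C2 * \<alpha> / (1 - beta CARD('n) lam)"
    unfolding C2 using De e by (simp only: distrib_right mult.assoc)
  have rate: "?r k \<le> (norm xs)\<^sup>2 / \<alpha> / real k"
    if "1 \<le> k" "\<And>s. s \<le> k \<Longrightarrow> (4 * D\<^sup>2 + Lh * D * norm xs + 1) * ?e < ?r s" for k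
  proof -
    have "real k * ?r k \<le> (norm xs)\<^sup>2 / \<alpha>" by (rule rate_until_level[OF opt that(2)])
    thus ?thesis using that(1) by (simp only: pos_le_divide_eq mult.commute of_nat_0_less_iff)
  qed
  have C1: "2 * ((norm xs)\<^sup>2 / \<alpha> / real k) \<le> C1 / \<alpha> / real k" for k
    unfolding C1_def using \<alpha>_pos by (simp add: add_divide_distrib)
  show ?A
    unfolding sublinear_until_def dgd_mean_eq
  proof (intro allI impI)
    fix k :: nat assume k: "1 \<le> k" and above: "\<forall>s\<le>k. C2 * \<alpha> / (1 - beta CARD('n) lam) < ?r s"
    have "?r k \<le> (norm xs)\<^sup>2 / \<alpha> / real k"
    proof (rule rate[OF k])
      fix s assume "s \<le> k"
      thus "(4 * D\<^sup>2 + Lh * D * norm xs + 1) * ?e < ?r s" using above De(1) unfolding C2 by fastforce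
    qed
    moreover have "0 \<le> (norm xs)\<^sup>2 / \<alpha> / real k" using \<alpha>_pos by simp
    ultimately show "?r k \<le> C1 / \<alpha> / real k" using C1[of k] by linarith
  qed
  show ?B
    unfolding sublinear_until_def
  proof (intro allI impI)
    let ?d = "\<lambda>s. favg f (dgd W \<alpha> f s i) - favg f xs"
    fix k :: nat assume k: "1 \<le> k" and above: "\<forall>s\<le>k. C2 * \<alpha> / (1 - beta CARD('n) lam) < ?d s"
    have d: "?d s \<le> ?r s + D\<^sup>2 * ?e" for s
      using local_error_le[of s i xs] by (simp add: dgd_mean_eq)
    have "?r k \<le> (norm xs)\<^sup>2 / \<alpha> / real k"
    proof (rule rate[OF k])
      fix s assume "s \<le> k"
      hence "C2 * \<alpha> / (1 - beta CARD('n) lam) < ?d s" using above by blast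
      thus "(4 * D\<^sup>2 + Lh * D * norm xs + 1) * ?e < ?r s" using d[of s] De(1) unfolding C2 by linarith
    qed
    moreover have "2 * (D\<^sup>2 * ?e) < ?d k" using above low by fastforce
    ultimately show "?d k \<le> C1 / \<alpha> / real k" using C1[of k] d[of k] by linarith
  qed
qed

end

theorem mainTheorem3:
  fixes f :: "'n::finite \<Rightarrow> real^'p \<Rightarrow> real"
    and L :: "'n \<Rightarrow> real"
    and E :: "('n \<times> 'n) set"
    and xstar :: "real^'p"
  assumes agents: "2 \<le> CARD('n)"
    and objectives: "\<And>i. admissible_objective (L i) (f i)"
    and network: "connected_network E"
    and optimum: "xstar \<in> minimizers (\<lambda>x. \<Sum>i\<in>UNIV. f i x)"
  shows
    "(\<forall>W lam \<alpha> k i. mixing_matrix E W lam \<and> admissible_step L lam \<alpha> \<longrightarrow>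
        (let x = dgd W \<alpha> f k i;
             xbar = dgd_mean W \<alpha> f k;
             rbar = favg f xbar - favg f xstar
         in favg f x - favg f xstar \<le> rbar + grad (favg f) x \<bullet> (x - xbar)
          \<and> rbar + grad (favg f) x \<bullet> (x - xbar)
              \<le> rbar + (1 / real CARD('n)) * (\<Sum>j\<in>UNIV. norm (grad (f j) x) * norm (x - xbar))
          \<and> rbar + (1 / real CARD('n)) * (\<Sum>j\<in>UNIV. norm (grad (f j) x) * norm (x - xbar))
              \<le> rbar + \<alpha> * (Dconst L f)\<^sup>2 / (1 - beta CARD('n) lam)))
     \<and> (\<exists>C1>0. \<exists>C2>0. \<forall>W lam \<alpha>. mixing_matrix E W lam \<and> admissible_step L lam \<alpha> \<longrightarrow>
          sublinear_until (C1 / \<alpha>) (C2 * \<alpha> / (1 - beta CARD('n) lam))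
            (\<lambda>k. favg f (dgd_mean W \<alpha> f k) - favg f xstar)
        \<and> (\<forall>i. sublinear_until (C1 / \<alpha>) (C2 * \<alpha> / (1 - beta CARD('n) lam))
                 (\<lambda>k. favg f (dgd W \<alpha> f k i) - favg f xstar)))"
proof (intro conjI)
  have run: "dgd_run f L E W lam \<alpha>" if "mixing_matrix E W lam \<and> admissible_step L lam \<alpha>" for W lam \<alpha>
    using that agents objectives by unfold_locales auto
  show "\<forall>W lam \<alpha> k i. mixing_matrix E W lam \<and> admissible_step L lam \<alpha> \<longrightarrow>
        (let x = dgd W \<alpha> f k i;
             xbar = dgd_mean W \<alpha> f k;
             rbar = favg f xbar - favg f xstar
         in favg f x - favg f xstar \<le> rbar + grad (favg f) x \<bullet> (x - xbar)
          \<and> rbar + grad (favg f) x \<bullet> (x - xbar)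
              \<le> rbar + (1 / real CARD('n)) * (\<Sum>j\<in>UNIV. norm (grad (f j) x) * norm (x - xbar))
          \<and> rbar + (1 / real CARD('n)) * (\<Sum>j\<in>UNIV. norm (grad (f j) x) * norm (x - xbar))
              \<le> rbar + \<alpha> * (Dconst L f)\<^sup>2 / (1 - beta CARD('n) lam))"
    unfolding Let_def using dgd_run.error_chain[OF run] by (auto intro!: add_left_mono)
  have opt: "favg f xstar \<le> favg f y" for y
    using optimum by (simp add: minimizers_def favg_def divide_right_mono)
  \<comment> \<open>Both constants involve only \<open>f\<close>, \<open>L\<close> and
    \<open>xstar\<close>, so one pair serves all matrices and stepsizes. The summands 1 keep them
    positive even if \<open>xstar\<close> or \<open>Dconst L f\<close> is 0.\<close>
  have C1: "0 < 2 * (norm xstar)\<^sup>2 + 1" by (simp add: add_nonneg_pos)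
  \<comment> \<open>Positivity of \<open>C2\<close> must be shown before any \<open>W\<close> and
    \<open>\<alpha>\<close> are given, hence outside the locale; \<open>undefined\<close> below is
    merely an arbitrary agent.\<close>
  have L_pos: "0 < L i" for i using objectives[of i] by (simp add: admissible_objective_def)
  have Lmax_pos: "0 < Lmax L"
    using less_le_trans[OF L_pos, of undefined "Lmax L"] by (simp add: Lmax_def)
  have "bdd_below (range (f i))" for i using objectives[of i] by (simp add: admissible_objective_def)
  hence "fopt_sum f \<le> (\<Sum>i\<in>UNIV. f i 0)" unfolding fopt_sum_def by (intro sum_mono cINF_lower) auto
  hence D: "0 \<le> Dconst L f" using Lmax_pos by (simp add: Dconst_def)
  have C2: "0 < 6 * (Dconst L f)\<^sup>2 + Lmax L * Dconst L f * norm xstar + 1"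
    using D Lmax_pos by (intro add_nonneg_pos add_nonneg_nonneg mult_nonneg_nonneg) auto
  show "\<exists>C1>0. \<exists>C2>0. \<forall>W lam \<alpha>. mixing_matrix E W lam \<and> admissible_step L lam \<alpha> \<longrightarrow>
          sublinear_until (C1 / \<alpha>) (C2 * \<alpha> / (1 - beta CARD('n) lam))
            (\<lambda>k. favg f (dgd_mean W \<alpha> f k) - favg f xstar)
        \<and> (\<forall>i. sublinear_until (C1 / \<alpha>) (C2 * \<alpha> / (1 - beta CARD('n) lam))
                 (\<lambda>k. favg f (dgd W \<alpha> f k i) - favg f xstar))"
    using dgd_run.sublinear_until_level[OF run opt] C1 C2 by blast
qed

end
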